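(* Let $G$ be a graph of order $n>3$ with $\chi_D(G)=n-1$. Then: (a) $\chi_D(G\cup G)=\chi_D(G)$ if and only if either ($a_1$) $G$ is the join of a nonvacuous complete multipartite graph with one of $2K_2$ or $H\cup K_1$, or ($a_2$) $G\cong H\cup K_1$ with $H\not\cong K_{n-1}$; (b) $\chi_D(G\cup G)=\chi_D(G)+1$ if and only if $G$ is $2K_2$ or $K_{n-1}\cup K_1$. Here $H$ denotes a complete multipartite graph with at least two parts.
   Context: $G\cup G$ is the disjoint union of two copies of $G$; $\cup$ denotes disjoint union and the join $A\vee B$ is the disjoint union of $A$ and $B$ together with all edges between $A$ and $B$. A distinguishing $k$-coloring of a graph is a partition of its vertex set into exactly $k$ non-empty independent sets such that the only automorphism mapping every class onto itself is the identity; $\chi_D$ is the least such $k$. Complete multipartite graphs include edgeless graphs (independent sets, viewed as having one part) and complete graphs; "nonvacuous" means having at least one vertex. *)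

theory Defs
  imports
    "Graph_Theory.Pair_Digraph"
    "Graph_Theory.Digraph_Isomorphism"
    "HOL-Library.Disjoint_Sets"
begin

text \<open>Finite simple graphs are \<open>pair_graph\<close>s: finite, symmetric and loopfree, with each
  undirected edge represented by its two arcs.\<close>

abbreviation isomorphic :: "'a pair_pre_digraph \<Rightarrow> 'b pair_pre_digraph \<Rightarrow> bool"  (infix \<open>\<simeq>\<close> 50) where
  "G \<simeq> H \<equiv> digraph_iso (with_proj G) (with_proj H)"

definition automorphism ::
    "'a pair_pre_digraph \<Rightarrow> ('a, 'a \<times> 'a, 'a, 'a \<times> 'a) digraph_isomorphism \<Rightarrow> bool" where
  "automorphism G h \<longleftrightarrow>
     pre_digraph.digraph_isomorphism (with_proj G) h \<and> app_iso h (with_proj G) = with_proj G"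

definition complete_graph :: "nat \<Rightarrow> nat pair_pre_digraph" where
  "complete_graph n = \<lparr> pverts = {..<n}, parcs = {(i, j). i < n \<and> j < n \<and> i \<noteq> j} \<rparr>"

definition disjoint_union ::
    "'a pair_pre_digraph \<Rightarrow> 'b pair_pre_digraph \<Rightarrow> ('a + 'b) pair_pre_digraph" where
  "disjoint_union G H =
     \<lparr> pverts = pverts G <+> pverts H,
       parcs = map_prod Inl Inl ` parcs G \<union> map_prod Inr Inr ` parcs H \<rparr>"

definition join ::
    "'a pair_pre_digraph \<Rightarrow> 'b pair_pre_digraph \<Rightarrow> ('a + 'b) pair_pre_digraph" where
  "join G H =
     \<lparr> pverts = pverts (disjoint_union G H),
       parcs = parcs (disjoint_union G H)
         \<union> Inl ` pverts G \<times> Inr ` pverts H \<union> Inr ` pverts H \<times> Inl ` pverts G \<rparr>"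

definition multipartition :: "'a pair_pre_digraph \<Rightarrow> 'a set set \<Rightarrow> bool" where
  "multipartition G P \<longleftrightarrow>
     partition_on (pverts G) P \<and>
     (\<forall>u \<in> pverts G. \<forall>v \<in> pverts G. (u, v) \<in> parcs G \<longleftrightarrow> \<not> (\<exists>C \<in> P. u \<in> C \<and> v \<in> C))"

text \<open>Edgeless graphs (one part) and complete graphs (singleton parts) are included.\<close>

definition complete_multipartite :: "'a pair_pre_digraph \<Rightarrow> bool" where
  "complete_multipartite G \<longleftrightarrow> pair_graph G \<and> (\<exists>P. multipartition G P)"

definition complete_multipartite_ge2 :: "'a pair_pre_digraph \<Rightarrow> bool" where
  "complete_multipartite_ge2 G \<longleftrightarrow> pair_graph G \<and> (\<exists>P. multipartition G P \<and> card P \<ge> 2)"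

definition distinguishing_coloring :: "'a pair_pre_digraph \<Rightarrow> 'a set set \<Rightarrow> bool" where
  "distinguishing_coloring G P \<longleftrightarrow>
     partition_on (pverts G) P \<and>
     (\<forall>C \<in> P. \<forall>u \<in> C. \<forall>v \<in> C. (u, v) \<notin> parcs G) \<and>
     (\<forall>h. automorphism G h \<and> (\<forall>C \<in> P. iso_verts h ` C = C)
        \<longrightarrow> (\<forall>v \<in> pverts G. iso_verts h v = v))"

definition chi_D :: "'a pair_pre_digraph \<Rightarrow> nat"  (\<open>\<chi>\<^sub>D\<close>) where
  "\<chi>\<^sub>D G = (LEAST k. \<exists>P. distinguishing_coloring G P \<and> card P = k)"

text \<open>Isomorphism and automorphisms in terms of vertex maps.\<close>

lemma digraph_isomorphism_onto_pair:
  fixes G :: "'a pair_pre_digraph" and H :: "'b pair_pre_digraph"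
  assumes H: "pair_wf_digraph H"
    and h: "pre_digraph.digraph_isomorphism (with_proj G) h" "with_proj H = app_iso h (with_proj G)"
  shows "bij_betw (iso_verts h) (pverts G) (pverts H)"
    and "u \<in> pverts G \<Longrightarrow> v \<in> pverts G \<Longrightarrow>
      (iso_verts h u, iso_verts h v) \<in> parcs H \<longleftrightarrow> (u, v) \<in> parcs G"
proof -
  have wf: "wf_digraph (with_proj G)" and inj: "inj_on (iso_verts h) (pverts G)"
    and comm: "\<And>a. a \<in> parcs G \<Longrightarrow>
      iso_verts h (fst a) = iso_tail h (iso_arcs h a) \<and> iso_verts h (snd a) = iso_head h (iso_arcs h a)"
    using h(1) by (auto simp: pre_digraph.digraph_isomorphism_def)
  have V: "pverts H = iso_verts h ` pverts G" and A: "parcs H = iso_arcs h ` parcs G"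
    and T: "iso_tail h = fst" and D: "iso_head h = snd"
    using h(2) by (auto simp: with_proj_def app_iso_def)
  show "bij_betw (iso_verts h) (pverts G) (pverts H)"
    using inj V by (simp add: bij_betw_def)
  have arc: "iso_arcs h a = (iso_verts h (fst a), iso_verts h (snd a))" if "a \<in> parcs G" for a
    using comm[OF that] T D by (simp add: prod_eq_iff)
  have inG: "fst a \<in> pverts G" "snd a \<in> pverts G" if "a \<in> parcs G" for a
    using wf that by (cases a; auto simp: wf_digraph_def)+
  show "(iso_verts h u, iso_verts h v) \<in> parcs H \<longleftrightarrow> (u, v) \<in> parcs G"
    if uv: "u \<in> pverts G" "v \<in> pverts G"
  proof
    assume "(iso_verts h u, iso_verts h v) \<in> parcs H"
    then obtain a where a: "a \<in> parcs G" "(iso_verts h u, iso_verts h v) = iso_arcs h a"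
      using A by auto
    then have "fst a = u" "snd a = v"
      using arc[OF a(1)] inG[OF a(1)] uv inj by (auto dest: inj_onD)
    with a(1) show "(u, v) \<in> parcs G" by auto
  next
    assume "(u, v) \<in> parcs G"
    then show "(iso_verts h u, iso_verts h v) \<in> parcs H"
      using A arc[of "(u, v)"] by force
  qed
qed

lemma digraph_isomorphism_of_vertex_map:
  fixes G :: "'a pair_pre_digraph" and H :: "'b pair_pre_digraph"
  assumes G: "pair_wf_digraph G" and H: "pair_wf_digraph H"
    and f: "bij_betw f (pverts G) (pverts H)"
    and adj: "\<And>u v. u \<in> pverts G \<Longrightarrow> v \<in> pverts G \<Longrightarrow> (f u, f v) \<in> parcs H \<longleftrightarrow> (u, v) \<in> parcs G"
  defines "h \<equiv> \<lparr> iso_verts = f, iso_arcs = map_prod f f, iso_head = snd, iso_tail = fst \<rparr>"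
  shows "pre_digraph.digraph_isomorphism (with_proj G) h"
    and "with_proj H = app_iso h (with_proj G)"
proof -
  interpret G: pair_wf_digraph G by fact
  interpret H: pair_wf_digraph H by fact
  have inj: "inj_on f (pverts G)" and V: "f ` pverts G = pverts H"
    using f by (auto simp: bij_betw_def)
  have "inj_on (map_prod f f) (parcs G)"
    by (rule inj_on_subset[OF map_prod_inj_on[OF inj inj]])
      (auto dest: G.in_arcsD1 G.in_arcsD2)
  then show "pre_digraph.digraph_isomorphism (with_proj G) h"
    using inj G.wf_digraph by (auto simp: pre_digraph.digraph_isomorphism_def h_def)
  have "parcs H = map_prod f f ` parcs G"
  proof (intro equalityI subrelI)
    fix x y assume xy: "(x, y) \<in> parcs H"
    then have "x \<in> f ` pverts G" "y \<in> f ` pverts G"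
      unfolding V by (auto dest: H.in_arcsD1 H.in_arcsD2)
    then obtain u v where "u \<in> pverts G" "v \<in> pverts G" "x = f u" "y = f v" by blast
    then show "(x, y) \<in> map_prod f f ` parcs G"
      using xy adj[of u v] by force
  next
    fix x y assume "(x, y) \<in> map_prod f f ` parcs G"
    then show "(x, y) \<in> parcs H"
      using adj by (auto dest: G.in_arcsD1 G.in_arcsD2)
  qed
  then show "with_proj H = app_iso h (with_proj G)"
    using V by (simp add: with_proj_def app_iso_def h_def)
qed

lemma isomorphic_iff:
  assumes "pair_wf_digraph G" "pair_wf_digraph H"
  shows "G \<simeq> H \<longleftrightarrow>
    (\<exists>f. bij_betw f (pverts G) (pverts H) \<and>
       (\<forall>u \<in> pverts G. \<forall>v \<in> pverts G. (f u, f v) \<in> parcs H \<longleftrightarrow> (u, v) \<in> parcs G))"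
    (is "_ \<longleftrightarrow> ?R")
proof
  assume "G \<simeq> H"
  then show ?R
    unfolding digraph_iso_def using digraph_isomorphism_onto_pair[OF assms(2)] by meson
next
  assume ?R
  then show "G \<simeq> H"
    unfolding digraph_iso_def using digraph_isomorphism_of_vertex_map[OF assms] by meson
qed

lemma ex_automorphism_iff:
  assumes "pair_wf_digraph G"
  shows "(\<exists>h. automorphism G h \<and> iso_verts h = f) \<longleftrightarrow>
    bij_betw f (pverts G) (pverts G) \<and>
    (\<forall>u \<in> pverts G. \<forall>v \<in> pverts G. (f u, f v) \<in> parcs G \<longleftrightarrow> (u, v) \<in> parcs G)"
    (is "_ \<longleftrightarrow> ?R")
proof
  assume "\<exists>h. automorphism G h \<and> iso_verts h = f"
  then show ?R
    unfolding automorphism_def using digraph_isomorphism_onto_pair[OF assms] by metis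
next
  assume ?R
  then have "automorphism G \<lparr> iso_verts = f, iso_arcs = map_prod f f, iso_head = snd, iso_tail = fst \<rparr>"
    unfolding automorphism_def
    using digraph_isomorphism_of_vertex_map[OF assms assms, of f] by (metis (no_types, lifting))
  then show "\<exists>h. automorphism G h \<and> iso_verts h = f"
    by (metis digraph_isomorphism.select_convs(1))
qed

lemma pair_graph_iff:
  "pair_graph G \<longleftrightarrow>
     finite (pverts G) \<and> parcs G \<subseteq> pverts G \<times> pverts G \<and> sym (parcs G) \<and> irrefl (parcs G)"
proof
  assume "pair_graph G"
  then interpret pair_graph G .
  show "finite (pverts G) \<and> parcs G \<subseteq> pverts G \<times> pverts G \<and> sym (parcs G) \<and> irrefl (parcs G)"
    using pair_finite_verts pair_sym_arcs pair_no_loops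
    by (auto simp: symmetric_def irrefl_def dest: in_arcsD1 in_arcsD2) blast+
next
  assume R: "finite (pverts G) \<and> parcs G \<subseteq> pverts G \<times> pverts G \<and> sym (parcs G) \<and> irrefl (parcs G)"
  then have "finite (parcs G)" by (meson finite_SigmaI finite_subset)
  with R show "pair_graph G"
    by unfold_locales (auto simp: symmetric_def irrefl_def)
qed

lemma pair_graph_complete_graph: "pair_graph (complete_graph n)"
  by (auto simp: pair_graph_iff complete_graph_def sym_def irrefl_def)

lemma pair_graph_disjoint_union:
  "pair_graph G \<Longrightarrow> pair_graph H \<Longrightarrow> pair_graph (disjoint_union G H)"
  by (fastforce simp: pair_graph_iff disjoint_union_def sym_def irrefl_def)

lemma pair_graph_join: "pair_graph G \<Longrightarrow> pair_graph H \<Longrightarrow> pair_graph (join G H)"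
  using pair_graph_disjoint_union[of G H]
  by (auto simp: pair_graph_iff join_def disjoint_union_def sym_def irrefl_def)

end

theory Submission
  imports Defs
begin

text \<open>Call a nonadjacent pair bad if its two vertices have different neighbourhoods. If
  \<open>\<chi>\<^sub>D G = n - 1\<close> then a bad pair exists, but colouring with \<open>n - 2\<close> colours is impossible: so no
  three vertices are pairwise bad, and two disjoint bad pairs can always be exchanged simultaneously by
  an automorphism. If two bad pairs are disjoint, this forces \<open>G\<close> to be \<open>2K\<^sub>2\<close> joined to a complete
  multipartite graph; otherwise the bad pairs form a star, whose centre and leaves induce \<open>K\<^sub>1 \<union> H\<close>.

  For two copies, restriction to one copy gives the lower bound. If \<open>G\<close> is a join, or is
  \<open>H \<union> K\<^sub>1\<close> with \<open>H\<close> not complete, then permuting the colours on one copy makes it distinguishable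
  from the other. For \<open>K\<^bsub>n-1\<^esub> \<union> K\<^sub>1\<close> and \<open>2K\<^sub>2\<close> this fails: with \<open>n - 1\<close> colours both copies of
  \<open>K\<^bsub>n-1\<^esub>\<close> use all colours, and four copies of \<open>K\<^sub>2\<close> share three possible colour pairs.\<close>

section \<open>Vertex maps and colourings\<close>

text \<open>The colourings constructed below use vertices as colours: every vertex is its own
  colour, except that a few borrow the colour of another. A colour-preserving automorphism then
  fixes everything outside the merged classes, and if it moves a vertex inside an independent set
  whose complement it fixes, that vertex and its image are twins. So merging a bad pair is always
  safe, and saving a second colour can fail only through an automorphism that moves two classes at
  once. This is why badness, and not mere nonadjacency, is the relation to study.

  For two copies the obstacle is an automorphism that mixes them. In a join any two vertices have
  distance at most two, so each copy moves as a whole, and a colour that occurs twice in one copy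
  but once in the other settles the matter. In \<open>H \<union> K1\<close> the isolated vertex
  moves independently of \<open>H\<close>: the two isolated vertices need different colours, and an
  exchange of the two copies of \<open>H\<close> has to be excluded separately.\<close>

definition vertex_iso ::
    "('a \<Rightarrow> 'b) \<Rightarrow> 'a pair_pre_digraph \<Rightarrow> 'b pair_pre_digraph \<Rightarrow> bool" where
  "vertex_iso f G H \<longleftrightarrow> bij_betw f (pverts G) (pverts H) \<and>
     (\<forall>u \<in> pverts G. \<forall>v \<in> pverts G. (f u, f v) \<in> parcs H \<longleftrightarrow> (u, v) \<in> parcs G)"

text \<open>Colour functions replace partitions so that merging classes and permuting colours are
  plain function manipulations. Asking only \<open>c (f v) = c v\<close> is enough: on a finite
  class an injective self-map is onto, so every class is mapped onto itself.\<close>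

definition distinguishing :: "'a pair_pre_digraph \<Rightarrow> ('a \<Rightarrow> 'c) \<Rightarrow> bool" where
  "distinguishing G c \<longleftrightarrow> (\<forall>(u, v) \<in> parcs G. c u \<noteq> c v) \<and>
     (\<forall>f. vertex_iso f G G \<longrightarrow> (\<forall>v \<in> pverts G. c (f v) = c v) \<longrightarrow> (\<forall>v \<in> pverts G. f v = v))"

definition induced :: "'a pair_pre_digraph \<Rightarrow> 'a set \<Rightarrow> 'a pair_pre_digraph" where
  "induced G X = \<lparr> pverts = X, parcs = parcs G \<inter> X \<times> X \<rparr>"

text \<open>This is transitivity of nonadjacency, in contrapositive form. In a loopfree symmetric
  graph it makes nonadjacency an equivalence relation, whose classes are the parts of a complete
  multipartite graph.\<close>

definition nonadj_trans :: "'a pair_pre_digraph \<Rightarrow> bool" where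
  "nonadj_trans G \<longleftrightarrow> (\<forall>u \<in> pverts G. \<forall>v \<in> pverts G. \<forall>w \<in> pverts G.
     (u, w) \<in> parcs G \<longrightarrow> (u, v) \<in> parcs G \<or> (v, w) \<in> parcs G)"

lemma pair_graph_wf: "pair_graph G \<Longrightarrow> pair_wf_digraph G"
  by (simp add: pair_graph_def pair_digraph_def pair_fin_digraph_def)

lemma pair_graphD:
  assumes "pair_graph G"
  shows "finite (pverts G)"
    and "(u, v) \<in> parcs G \<Longrightarrow> u \<in> pverts G"
    and "(u, v) \<in> parcs G \<Longrightarrow> v \<in> pverts G"
    and "(u, v) \<in> parcs G \<Longrightarrow> (v, u) \<in> parcs G"
    and "(u, u) \<notin> parcs G"
  using assms by (auto simp: pair_graph_iff sym_def irrefl_def)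

lemma isomorphic_vertex_iso:
  assumes "pair_graph G" "pair_graph H"
  shows "G \<simeq> H \<longleftrightarrow> (\<exists>f. vertex_iso f G H)"
  using isomorphic_iff[OF assms[THEN pair_graph_wf]] by (simp add: vertex_iso_def)

lemma chi_D_le:
  assumes G: "pair_graph G" and c: "distinguishing G c"
  shows "\<chi>\<^sub>D G \<le> card (c ` pverts G)"
proof -
  let ?V = "pverts G"
  define P where "P = (\<lambda>k. {w \<in> ?V. c w = k}) ` c ` ?V"
  have part: "partition_on ?V P"
    unfolding P_def by (rule partition_onI) (auto simp: disjnt_def)
  have "distinguishing_coloring G P"
    unfolding distinguishing_coloring_def
  proof (intro conjI allI impI part)
    show "\<forall>C \<in> P. \<forall>u \<in> C. \<forall>v \<in> C. (u, v) \<notin> parcs G"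
      using c by (auto simp: P_def distinguishing_def)
    fix h assume h: "automorphism G h \<and> (\<forall>C \<in> P. iso_verts h ` C = C)"
    then have iso: "vertex_iso (iso_verts h) G G"
      using ex_automorphism_iff[OF pair_graph_wf[OF G], of "iso_verts h"]
      by (auto simp: vertex_iso_def)
    have "c (iso_verts h v) = c v" if "v \<in> ?V" for v
    proof -
      let ?C = "{w \<in> ?V. c w = c v}"
      have "iso_verts h ` ?C = ?C" using h that by (auto simp: P_def)
      then have "iso_verts h v \<in> ?C" using that by blast
      then show ?thesis by simp
    qed
    then show "\<forall>v \<in> ?V. iso_verts h v = v"
      using c iso by (simp add: distinguishing_def)
  qed
  then have "\<chi>\<^sub>D G \<le> card P"
    unfolding chi_D_def by (intro Least_le) blast
  also have "card P \<le> card (c ` ?V)"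
    unfolding P_def using pair_graphD(1)[OF G] by (intro card_image_le) simp
  finally show ?thesis .
qed

text \<open>The partition into singletons is distinguishing, so the minimum ranges over a nonempty
  set and is attained. Each vertex is coloured by its own class, which explains the colour type
  \<open>'a set\<close>.\<close>

lemma chi_D_attained:
  assumes G: "pair_graph G"
  obtains c :: "'a \<Rightarrow> 'a set" where "distinguishing (G :: 'a pair_pre_digraph) c"
    "card (c ` pverts G) = \<chi>\<^sub>D G"
proof -
  let ?V = "pverts G"
  have "distinguishing_coloring G ((\<lambda>v. {v}) ` ?V)"
    unfolding distinguishing_coloring_def using pair_graphD(5)[OF G]
    by (auto intro!: partition_onI simp: disjnt_def)
  then have "\<exists>k P. distinguishing_coloring G P \<and> card P = k" by blast
  then have "\<exists>P. distinguishing_coloring G P \<and> card P = \<chi>\<^sub>D G"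
    unfolding chi_D_def by (rule LeastI_ex)
  then obtain P where P: "distinguishing_coloring G P" "card P = \<chi>\<^sub>D G" by blast
  then have part: "partition_on ?V P" by (simp add: distinguishing_coloring_def)
  then have "\<forall>v \<in> ?V. \<exists>C \<in> P. v \<in> C" by (auto simp: partition_on_def)
  then obtain c where c: "\<And>v. v \<in> ?V \<Longrightarrow> c v \<in> P" "\<And>v. v \<in> ?V \<Longrightarrow> v \<in> c v" by metis
  have sub: "C \<subseteq> ?V" if "C \<in> P" for C using part that by (auto simp: partition_on_def)
  have c_eq: "c v = C" if "C \<in> P" "v \<in> C" for v C
  proof -
    have "v \<in> ?V" using sub that by blast
    then have "c v \<in> P" "v \<in> c v \<inter> C" using c that by auto
    then show ?thesis using part that(1) by (metis disjointD empty_iff partition_on_def)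
  qed
  have "c ` ?V = P"
  proof
    show "P \<subseteq> c ` ?V"
    proof
      fix C assume C: "C \<in> P"
      then obtain v where "v \<in> C" using part by (metis all_not_in_conv partition_on_def)
      then show "C \<in> c ` ?V" using C c_eq sub by blast
    qed
  qed (use c in auto)
  moreover have "distinguishing G c"
    unfolding distinguishing_def
  proof (intro conjI allI impI)
    show "\<forall>(u, v) \<in> parcs G. c u \<noteq> c v"
    proof safe
      fix u v assume uv: "(u, v) \<in> parcs G" "c u = c v"
      then have "u \<in> c v" "v \<in> c v" "c v \<in> P" using c pair_graphD(2,3)[OF G uv(1)] by auto
      then show False using P(1) uv(1) by (auto simp: distinguishing_coloring_def)
    qed
    fix f assume f: "vertex_iso f G G" "\<forall>v \<in> ?V. c (f v) = c v"
    then obtain h where h: "automorphism G h" "iso_verts h = f"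
      using ex_automorphism_iff[OF pair_graph_wf[OF G], of f] by (auto simp: vertex_iso_def)
    \<comment> \<open>Preserving colours gives only inclusion; injectivity and finiteness give
      equality.\<close>
    have "f ` C = C" if C: "C \<in> P" for C
    proof (rule endo_inj_surj)
      show "finite C" using sub[OF C] pair_graphD(1)[OF G] by (rule finite_subset)
      show "inj_on f C"
        using f(1) sub[OF C] by (auto simp: vertex_iso_def bij_betw_def intro: inj_on_subset)
      show "f ` C \<subseteq> C"
      proof safe
        fix v assume v: "v \<in> C"
        then have "f v \<in> ?V" using f(1) sub[OF C] by (auto simp: vertex_iso_def bij_betw_def)
        then have "f v \<in> c (f v)" by (rule c)
        moreover have "c (f v) = C" using f(2) v sub[OF C] c_eq[OF C v] by auto
        ultimately show "f v \<in> C" by simp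
      qed
    qed
    then have "automorphism G h \<and> (\<forall>C \<in> P. iso_verts h ` C = C)" using h by simp
    then have "\<forall>v \<in> ?V. iso_verts h v = v"
      using P(1) unfolding distinguishing_coloring_def by meson
    then show "\<forall>v \<in> ?V. f v = v" using h(2) by simp
  qed
  ultimately show thesis using that[of c] P(2) by simp
qed

section \<open>Joins, disjoint unions and induced subgraphs in terms of vertex maps\<close>

lemma vertex_isoD:
  assumes "vertex_iso f G H"
  shows "u \<in> pverts G \<Longrightarrow> f u \<in> pverts H"
    and "u \<in> pverts G \<Longrightarrow> v \<in> pverts G \<Longrightarrow> (f u, f v) \<in> parcs H \<longleftrightarrow> (u, v) \<in> parcs G"
    and "inj_on f (pverts G)"
    and "f ` pverts G = pverts H"
  using assms by (auto simp: vertex_iso_def bij_betw_def)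

lemma disjoint_union_simps [simp]:
  "pverts (disjoint_union G H) = Inl ` pverts G \<union> Inr ` pverts H"
  "(Inl u, Inl v) \<in> parcs (disjoint_union G H) \<longleftrightarrow> (u, v) \<in> parcs G"
  "(Inr x, Inr y) \<in> parcs (disjoint_union G H) \<longleftrightarrow> (x, y) \<in> parcs H"
  "(Inl u, Inr y) \<notin> parcs (disjoint_union G H)"
  "(Inr x, Inl v) \<notin> parcs (disjoint_union G H)"
  by (auto simp: disjoint_union_def Plus_def)

lemma join_simps [simp]:
  "pverts (join G H) = Inl ` pverts G \<union> Inr ` pverts H"
  "(Inl u, Inl v) \<in> parcs (join G H) \<longleftrightarrow> (u, v) \<in> parcs G"
  "(Inr x, Inr y) \<in> parcs (join G H) \<longleftrightarrow> (x, y) \<in> parcs H"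
  "(Inl u, Inr y) \<in> parcs (join G H) \<longleftrightarrow> u \<in> pverts G \<and> y \<in> pverts H"
  "(Inr x, Inl v) \<in> parcs (join G H) \<longleftrightarrow> v \<in> pverts G \<and> x \<in> pverts H"
  by (auto simp: disjoint_union_def join_def Plus_def)

lemma induced_simps [simp]:
  "pverts (induced G X) = X"
  "(u, v) \<in> parcs (induced G X) \<longleftrightarrow> (u, v) \<in> parcs G \<and> u \<in> X \<and> v \<in> X"
  by (auto simp: induced_def)

lemma complete_graph_simps [simp]:
  "pverts (complete_graph k) = {..<k}"
  "(i, j) \<in> parcs (complete_graph k) \<longleftrightarrow> i < k \<and> j < k \<and> i \<noteq> j"
  by (auto simp: complete_graph_def)

lemma pair_graph_induced: "pair_graph G \<Longrightarrow> X \<subseteq> pverts G \<Longrightarrow> pair_graph (induced G X)"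
  by (auto simp: pair_graph_iff induced_def sym_def irrefl_def intro: finite_subset)

lemma induced_induced: "Y \<subseteq> X \<Longrightarrow> induced (induced G X) Y = induced G Y"
  by (auto simp: induced_def)

lemma isomorphic_joinI:
  assumes G: "pair_graph G" and A: "pair_graph A" and B: "pair_graph B"
    and V: "pverts G = X \<union> Y" "X \<inter> Y = {}"
    and e: "\<And>x y. x \<in> X \<Longrightarrow> y \<in> Y \<Longrightarrow> (x, y) \<in> parcs G"
    and "induced G X \<simeq> A" "induced G Y \<simeq> B"
  shows "G \<simeq> join A B"
proof -
  have e': "(y, x) \<in> parcs G" if "x \<in> X" "y \<in> Y" for x y
    using e[OF that] by (rule pair_graphD(4)[OF G])
  obtain f g where fg: "vertex_iso f (induced G X) A" "vertex_iso g (induced G Y) B"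
    using assms pair_graph_induced[OF G] by (auto simp: isomorphic_vertex_iso)
  let ?h = "\<lambda>v. if v \<in> X then Inl (f v) else Inr (g v)"
  have fX: "f x \<in> pverts A" if "x \<in> X" for x using vertex_isoD(1)[OF fg(1)] that by simp
  have gY: "g y \<in> pverts B" if "y \<in> Y" for y using vertex_isoD(1)[OF fg(2)] that by simp
  have "bij_betw (\<lambda>v. Inl (f v)) X (Inl ` pverts A)" "bij_betw (\<lambda>v. Inr (g v)) Y (Inr ` pverts B)"
    using fg by (auto simp: vertex_iso_def bij_betw_def inj_on_def)
  then have "bij_betw ?h (X \<union> Y) (Inl ` pverts A \<union> Inr ` pverts B)"
    using V(2) by (intro bij_betw_disjoint_Un) auto
  moreover have "(?h u, ?h v) \<in> parcs (join A B) \<longleftrightarrow> (u, v) \<in> parcs G"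
    if "u \<in> X \<union> Y" "v \<in> X \<union> Y" for u v
    using that V(2) e[of u v] e'[of v u] fX gY vertex_isoD(2)[OF fg(1), of u v]
      vertex_isoD(2)[OF fg(2), of u v] by (cases "u \<in> X"; cases "v \<in> X") auto
  ultimately have "vertex_iso ?h G (join A B)"
    using V(1) by (simp add: vertex_iso_def)
  then show ?thesis using isomorphic_vertex_iso[OF G pair_graph_join[OF A B]] by blast
qed

lemma isomorphic_disjoint_unionI:
  assumes G: "pair_graph G" and A: "pair_graph A" and B: "pair_graph B"
    and V: "pverts G = X \<union> Y" "X \<inter> Y = {}"
    and e: "\<And>x y. x \<in> X \<Longrightarrow> y \<in> Y \<Longrightarrow> (x, y) \<notin> parcs G"
    and "induced G X \<simeq> A" "induced G Y \<simeq> B"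
  shows "G \<simeq> disjoint_union A B"
proof -
  have e': "(y, x) \<notin> parcs G" if "x \<in> X" "y \<in> Y" for x y
    using e[OF that] pair_graphD(4)[OF G] by blast
  obtain f g where fg: "vertex_iso f (induced G X) A" "vertex_iso g (induced G Y) B"
    using assms pair_graph_induced[OF G] by (auto simp: isomorphic_vertex_iso)
  let ?h = "\<lambda>v. if v \<in> X then Inl (f v) else Inr (g v)"
  have fX: "f x \<in> pverts A" if "x \<in> X" for x using vertex_isoD(1)[OF fg(1)] that by simp
  have gY: "g y \<in> pverts B" if "y \<in> Y" for y using vertex_isoD(1)[OF fg(2)] that by simp
  have "bij_betw (\<lambda>v. Inl (f v)) X (Inl ` pverts A)" "bij_betw (\<lambda>v. Inr (g v)) Y (Inr ` pverts B)"
    using fg by (auto simp: vertex_iso_def bij_betw_def inj_on_def)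
  then have "bij_betw ?h (X \<union> Y) (Inl ` pverts A \<union> Inr ` pverts B)"
    using V(2) by (intro bij_betw_disjoint_Un) auto
  moreover have "(?h u, ?h v) \<in> parcs (disjoint_union A B) \<longleftrightarrow> (u, v) \<in> parcs G"
    if "u \<in> X \<union> Y" "v \<in> X \<union> Y" for u v
    using that V(2) e[of u v] e'[of v u] fX gY vertex_isoD(2)[OF fg(1), of u v]
      vertex_isoD(2)[OF fg(2), of u v] by (cases "u \<in> X"; cases "v \<in> X") auto
  ultimately have "vertex_iso ?h G (disjoint_union A B)"
    using V(1) by (simp add: vertex_iso_def)
  then show ?thesis using isomorphic_vertex_iso[OF G pair_graph_disjoint_union[OF A B]] by blast
qed

lemma isomorphic_joinE:
  assumes G: "pair_graph G" and A: "pair_graph A" and B: "pair_graph B"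
    and iso: "G \<simeq> join A B" and ne: "pverts A \<noteq> {}" "pverts B \<noteq> {}"
  obtains X Y where "pverts G = X \<union> Y" "X \<noteq> {}" "Y \<noteq> {}"
    "\<And>x y. x \<in> X \<Longrightarrow> y \<in> Y \<Longrightarrow> (x, y) \<in> parcs G"
proof -
  obtain f where f: "vertex_iso f G (join A B)"
    using iso isomorphic_vertex_iso[OF G pair_graph_join[OF A B]] by blast
  let ?X = "{v \<in> pverts G. f v \<in> Inl ` pverts A}" and ?Y = "{v \<in> pverts G. f v \<in> Inr ` pverts B}"
  have sur: "\<exists>v \<in> pverts G. f v = w" if "w \<in> Inl ` pverts A \<union> Inr ` pverts B" for w
  proof -
    have "w \<in> f ` pverts G" unfolding vertex_isoD(4)[OF f] using that by simp
    then show ?thesis by auto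
  qed
  show thesis
  proof (rule that)
    show "pverts G = ?X \<union> ?Y" using vertex_isoD(1)[OF f] by auto
    obtain a b where ab: "a \<in> pverts A" "b \<in> pverts B" using ne by blast
    show "?X \<noteq> {}" "?Y \<noteq> {}" using sur[of "Inl a"] sur[of "Inr b"] ab by auto
    show "(x, y) \<in> parcs G" if "x \<in> ?X" "y \<in> ?Y" for x y
      using that vertex_isoD(2)[OF f, of x y] by auto
  qed
qed

lemma isomorphic_disjoint_unionE:
  assumes G: "pair_graph G" and A: "pair_graph A" and B: "pair_graph B"
    and iso: "G \<simeq> disjoint_union A B"
  obtains X Y where "pverts G = X \<union> Y" "X \<inter> Y = {}"
    "\<forall>x \<in> X. \<forall>y \<in> Y. (x, y) \<notin> parcs G"
    "induced G X \<simeq> A" "induced G Y \<simeq> B"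
proof -
  obtain f where f: "vertex_iso f G (disjoint_union A B)"
    using iso isomorphic_vertex_iso[OF G pair_graph_disjoint_union[OF A B]] by blast
  let ?X = "{v \<in> pverts G. f v \<in> Inl ` pverts A}" and ?Y = "{v \<in> pverts G. f v \<in> Inr ` pverts B}"
  have sur: "\<exists>v \<in> pverts G. f v = w" if "w \<in> Inl ` pverts A \<union> Inr ` pverts B" for w
  proof -
    have "w \<in> f ` pverts G" unfolding vertex_isoD(4)[OF f] using that by simp
    then show ?thesis by auto
  qed
  have adj: "(f u, f v) \<in> parcs (disjoint_union A B) \<longleftrightarrow> (u, v) \<in> parcs G"
    if "u \<in> pverts G" "v \<in> pverts G" for u v
    using vertex_isoD(2)[OF f that] .
  have inj: "u = v" if "f u = f v" "u \<in> pverts G" "v \<in> pverts G" for u v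
    using vertex_isoD(3)[OF f] that by (auto dest: inj_onD)
  have "vertex_iso (projl \<circ> f) (induced G ?X) A"
    unfolding vertex_iso_def
  proof
    show "bij_betw (projl \<circ> f) (pverts (induced G ?X)) (pverts A)"
      unfolding bij_betw_def
    proof
      show "inj_on (projl \<circ> f) (pverts (induced G ?X))"
        by (rule inj_onI) (auto intro: inj)
      show "(projl \<circ> f) ` pverts (induced G ?X) = pverts A"
      proof safe
        fix a assume "a \<in> pverts A"
        then obtain v where "v \<in> pverts G" "f v = Inl a" using sur[of "Inl a"] by auto
        then show "a \<in> (projl \<circ> f) ` pverts (induced G ?X)"
          using \<open>a \<in> pverts A\<close> by (intro image_eqI[of _ _ v]) auto
      qed auto
    qed
    show "\<forall>u \<in> pverts (induced G ?X). \<forall>v \<in> pverts (induced G ?X).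
        ((projl \<circ> f) u, (projl \<circ> f) v) \<in> parcs A \<longleftrightarrow> (u, v) \<in> parcs (induced G ?X)"
    proof (intro ballI)
      fix u v assume "u \<in> pverts (induced G ?X)" "v \<in> pverts (induced G ?X)"
      then show "((projl \<circ> f) u, (projl \<circ> f) v) \<in> parcs A \<longleftrightarrow> (u, v) \<in> parcs (induced G ?X)"
        using adj[of u v] by auto
    qed
  qed
  moreover have "vertex_iso (projr \<circ> f) (induced G ?Y) B"
    unfolding vertex_iso_def
  proof
    show "bij_betw (projr \<circ> f) (pverts (induced G ?Y)) (pverts B)"
      unfolding bij_betw_def
    proof
      show "inj_on (projr \<circ> f) (pverts (induced G ?Y))"
        by (rule inj_onI) (auto intro: inj)
      show "(projr \<circ> f) ` pverts (induced G ?Y) = pverts B"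
      proof safe
        fix a assume "a \<in> pverts B"
        then obtain v where "v \<in> pverts G" "f v = Inr a" using sur[of "Inr a"] by auto
        then show "a \<in> (projr \<circ> f) ` pverts (induced G ?Y)"
          using \<open>a \<in> pverts B\<close> by (intro image_eqI[of _ _ v]) auto
      qed auto
    qed
    show "\<forall>u \<in> pverts (induced G ?Y). \<forall>v \<in> pverts (induced G ?Y).
        ((projr \<circ> f) u, (projr \<circ> f) v) \<in> parcs B \<longleftrightarrow> (u, v) \<in> parcs (induced G ?Y)"
    proof (intro ballI)
      fix u v assume "u \<in> pverts (induced G ?Y)" "v \<in> pverts (induced G ?Y)"
      then show "((projr \<circ> f) u, (projr \<circ> f) v) \<in> parcs B \<longleftrightarrow> (u, v) \<in> parcs (induced G ?Y)"
        using adj[of u v] by auto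
    qed
  qed
  moreover have "pair_graph (induced G ?X)" "pair_graph (induced G ?Y)"
    by (rule pair_graph_induced[OF G]; blast)+
  ultimately have isos: "induced G ?X \<simeq> A" "induced G ?Y \<simeq> B"
    using A B by (auto simp: isomorphic_vertex_iso)
  have "pverts G = ?X \<union> ?Y" "?X \<inter> ?Y = {}" using vertex_isoD(1)[OF f] by auto
  moreover have "\<forall>x \<in> ?X. \<forall>y \<in> ?Y. (x, y) \<notin> parcs G"
  proof (intro ballI)
    fix x y assume "x \<in> ?X" "y \<in> ?Y"
    then show "(x, y) \<notin> parcs G" using adj[of x y] by auto
  qed
  ultimately show thesis using isos by (rule that)
qed

lemma isomorphic_complete_graph_iff:
  assumes G: "pair_graph G"
  shows "G \<simeq> complete_graph k \<longleftrightarrow> card (pverts G) = k \<and>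
    (\<forall>u \<in> pverts G. \<forall>v \<in> pverts G. u \<noteq> v \<longrightarrow> (u, v) \<in> parcs G)"
    (is "_ \<longleftrightarrow> ?R")
proof
  assume "G \<simeq> complete_graph k"
  then obtain f where f: "vertex_iso f G (complete_graph k)"
    using isomorphic_vertex_iso[OF G pair_graph_complete_graph] by blast
  have "card (pverts G) = k"
    using f bij_betw_same_card by (fastforce simp: vertex_iso_def)
  moreover have "(u, v) \<in> parcs G" if "u \<in> pverts G" "v \<in> pverts G" "u \<noteq> v" for u v
  proof -
    have "f u \<noteq> f v" using that vertex_isoD(3)[OF f] by (auto dest: inj_onD)
    then show ?thesis using that vertex_isoD(1,2)[OF f] by fastforce
  qed
  ultimately show ?R by blast
next
  assume R: ?R
  obtain f where f: "bij_betw f (pverts G) {0..<k}"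
    using ex_bij_betw_finite_nat[OF pair_graphD(1)[OF G]] R by blast
  have "vertex_iso f G (complete_graph k)"
    unfolding vertex_iso_def
  proof (intro conjI ballI)
    show "bij_betw f (pverts G) (pverts (complete_graph k))"
      using f by (simp add: lessThan_atLeast0)
    fix u v assume V: "u \<in> pverts G" "v \<in> pverts G"
    then have "f u < k" "f v < k" "f u = f v \<longleftrightarrow> u = v"
      using f by (auto simp: bij_betw_def inj_on_def)
    then show "(f u, f v) \<in> parcs (complete_graph k) \<longleftrightarrow> (u, v) \<in> parcs G"
      using V R pair_graphD(5)[OF G, of v] by auto
  qed
  then show "G \<simeq> complete_graph k"
    using isomorphic_vertex_iso[OF G pair_graph_complete_graph] by blast
qed

section \<open>Complete multipartite graphs through transitivity of nonadjacency\<close>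

text \<open>Given a partition, two nonadjacent pairs sharing \<open>v\<close> lie in the same part
  by disjointness. Conversely the classes of nonadjacency serve as parts. The local form is
  inherited by induced subgraphs and is easy to check when no bad pair is present.\<close>

lemma complete_multipartite_iff:
  "complete_multipartite G \<longleftrightarrow> pair_graph G \<and> nonadj_trans G"
proof safe
  assume cm: "complete_multipartite G"
  then show G: "pair_graph G" by (simp add: complete_multipartite_def)
  obtain P where P: "partition_on (pverts G) P"
    "\<And>u v. u \<in> pverts G \<Longrightarrow> v \<in> pverts G \<Longrightarrow> (u, v) \<in> parcs G \<longleftrightarrow> \<not> (\<exists>C \<in> P. u \<in> C \<and> v \<in> C)"
    using cm by (auto simp: complete_multipartite_def multipartition_def)
  show "nonadj_trans G"
    unfolding nonadj_trans_def
  proof (intro ballI impI)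
    fix u v w assume V: "u \<in> pverts G" "v \<in> pverts G" "w \<in> pverts G" and uw: "(u, w) \<in> parcs G"
    show "(u, v) \<in> parcs G \<or> (v, w) \<in> parcs G"
    proof (rule ccontr)
      assume "\<not> ?thesis"
      then obtain C D where CD: "C \<in> P" "D \<in> P" "u \<in> C" "v \<in> C" "v \<in> D" "w \<in> D"
        using P(2) V by meson
      have "disjoint P" using P(1) by (simp add: partition_on_def)
      then have "C = D" using disjointD[OF _ CD(1,2)] CD(4,5) by blast
      then show False using P(2)[OF V(1,3)] uw CD by blast
    qed
  qed
next
  assume G: "pair_graph G" and co: "nonadj_trans G"
  define R where "R = {(u, v). u \<in> pverts G \<and> v \<in> pverts G \<and> (u, v) \<notin> parcs G}"
  have R: "equiv (pverts G) R"
    using co pair_graphD[OF G]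
    by (auto simp: R_def equiv_def refl_on_def sym_def trans_def nonadj_trans_def)
  have "(u, v) \<in> parcs G \<longleftrightarrow> \<not> (\<exists>C \<in> pverts G // R. u \<in> C \<and> v \<in> C)"
    if "u \<in> pverts G" "v \<in> pverts G" for u v
  proof -
    have "(\<exists>C \<in> pverts G // R. u \<in> C \<and> v \<in> C) \<longleftrightarrow> (u, v) \<in> R"
    proof
      assume "\<exists>C \<in> pverts G // R. u \<in> C \<and> v \<in> C"
      then show "(u, v) \<in> R" using in_quotient_imp_in_rel[OF R, of _ u v] by auto
    next
      assume "(u, v) \<in> R"
      then have "v \<in> R `` {u}" by simp
      moreover have "u \<in> R `` {u}" using R that(1) by (rule equiv_class_self)
      ultimately show "\<exists>C \<in> pverts G // R. u \<in> C \<and> v \<in> C" using quotientI[OF that(1)] by metis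
    qed
    moreover have "(u, v) \<in> R \<longleftrightarrow> (u, v) \<notin> parcs G" using that by (simp add: R_def)
    ultimately show ?thesis by metis
  qed
  then show "complete_multipartite G"
    using G partition_on_quotient[OF R]
    unfolding complete_multipartite_def multipartition_def by blast
qed

text \<open>Vertices of different parts are adjacent, and the ends of an arc lie in different parts.
  Hence "at least two parts" does not depend on the chosen partition and can be replaced by the
  existence of an arc.\<close>

lemma multipartition_card_ge2_iff:
  assumes G: "pair_graph G" and P: "multipartition G P"
  shows "2 \<le> card P \<longleftrightarrow> parcs G \<noteq> {}"
proof -
  have part: "\<Union> P = pverts G" "disjoint P" "{} \<notin> P"
    and adj: "\<And>u v. u \<in> pverts G \<Longrightarrow> v \<in> pverts G \<Longrightarrow> (u, v) \<in> parcs G \<longleftrightarrow> \<not> (\<exists>C \<in> P. u \<in> C \<and> v \<in> C)"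
    using P by (auto simp: multipartition_def partition_on_def)
  have fin: "finite P" using part(1) pair_graphD(1)[OF G] finite_UnionD by metis
  have "2 \<le> card P \<longleftrightarrow> \<not> card P \<le> Suc 0" by arith
  also have "\<dots> \<longleftrightarrow> (\<exists>C \<in> P. \<exists>D \<in> P. C \<noteq> D)" using card_le_Suc0_iff_eq[OF fin] by blast
  also have "\<dots> \<longleftrightarrow> parcs G \<noteq> {}"
  proof
    assume "\<exists>C \<in> P. \<exists>D \<in> P. C \<noteq> D"
    then obtain C D where CD: "C \<in> P" "D \<in> P" "C \<noteq> D" by blast
    have "C \<noteq> {}" "D \<noteq> {}" using CD part(3) by metis+
    then obtain u v where uv: "u \<in> C" "v \<in> D" by blast
    then have V: "u \<in> pverts G" "v \<in> pverts G" using part(1) CD by blast+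
    have "E = C" "E = D" if "E \<in> P" "u \<in> E" "v \<in> E" for E
      using disjointD[OF part(2) that(1) CD(1)] disjointD[OF part(2) that(1) CD(2)] uv that by blast+
    then have "\<not> (\<exists>C \<in> P. u \<in> C \<and> v \<in> C)" using CD(3) by metis
    then show "parcs G \<noteq> {}" using adj[OF V] by auto
  next
    assume "parcs G \<noteq> {}"
    then obtain u v where uv: "(u, v) \<in> parcs G" by auto
    then have V: "u \<in> pverts G" "v \<in> pverts G" by (rule pair_graphD[OF G])+
    then obtain C D where "C \<in> P" "D \<in> P" "u \<in> C" "v \<in> D" using part(1) by blast
    then show "\<exists>C \<in> P. \<exists>D \<in> P. C \<noteq> D" using adj[OF V] uv by metis
  qed
  finally show ?thesis .
qed

lemma complete_multipartite_ge2_iff: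
  "complete_multipartite_ge2 G \<longleftrightarrow> pair_graph G \<and> nonadj_trans G \<and> parcs G \<noteq> {}"
proof -
  have "complete_multipartite_ge2 G \<longleftrightarrow>
      pair_graph G \<and> (\<exists>P. multipartition G P \<and> parcs G \<noteq> {})"
    unfolding complete_multipartite_ge2_def
    by (intro conj_cong refl ex_cong1) (simp add: multipartition_card_ge2_iff)
  then show ?thesis
    using complete_multipartite_iff[of G] by (auto simp: complete_multipartite_def)
qed

lemma nonadj_trans_iso:
  assumes f: "vertex_iso f G H"
  shows "nonadj_trans G \<longleftrightarrow> nonadj_trans H"
  by (simp add: nonadj_trans_def vertex_isoD(4)[OF f, symmetric] vertex_isoD(2)[OF f])

lemma parcs_empty_iff:
  assumes "pair_graph G"
  shows "parcs G = {} \<longleftrightarrow> (\<forall>u \<in> pverts G. \<forall>v \<in> pverts G. (u, v) \<notin> parcs G)"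
  by (auto dest: pair_graphD(2,3)[OF assms])

lemma vertex_iso_parcs_empty:
  assumes f: "vertex_iso f G H" and "pair_graph G" "pair_graph H"
  shows "parcs G = {} \<longleftrightarrow> parcs H = {}"
  by (simp add: parcs_empty_iff assms(2,3) vertex_isoD(4)[OF f, symmetric] vertex_isoD(2)[OF f])

text \<open>The theorem asks for witnesses on natural numbers, while the pieces found inside
  \<open>G\<close> live on its own vertex type. Finiteness allows the copying.\<close>

lemma ex_nat_graph:
  assumes G: "pair_graph G"
  obtains H :: "nat pair_pre_digraph" and f where "pair_graph H" "vertex_iso f G H" "G \<simeq> H"
proof -
  obtain f where f: "bij_betw f (pverts G) {0..<card (pverts G)}"
    using ex_bij_betw_finite_nat[OF pair_graphD(1)[OF G]] by blast
  then have inj: "inj_on f (pverts G)" by (simp add: bij_betw_def)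
  let ?H = "\<lparr> pverts = f ` pverts G, parcs = map_prod f f ` parcs G \<rparr>"
  have adj: "(f u, f v) \<in> map_prod f f ` parcs G \<longleftrightarrow> (u, v) \<in> parcs G"
    if uv: "u \<in> pverts G" "v \<in> pverts G" for u v
  proof
    assume "(f u, f v) \<in> map_prod f f ` parcs G"
    then obtain a b where ab: "(a, b) \<in> parcs G" "f a = f u" "f b = f v" by auto
    then have "a = u" "b = v" using inj uv pair_graphD(2,3)[OF G ab(1)] by (auto dest: inj_onD)
    then show "(u, v) \<in> parcs G" using ab(1) by simp
  qed force
  then have iso: "vertex_iso f G ?H"
    using inj by (simp add: vertex_iso_def bij_betw_def)
  moreover have "pair_graph ?H"
    unfolding pair_graph_iff
  proof (intro conjI)
    show "irrefl (parcs ?H)"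
    proof (rule irreflI)
      fix x show "(x, x) \<notin> parcs ?H"
      proof
        assume x: "(x, x) \<in> parcs ?H"
        then obtain u where "x = f u" "u \<in> pverts G" using pair_graphD(2)[OF G] by auto
        then show False using x adj[of u u] pair_graphD(5)[OF G] by simp
      qed
    qed
    show "sym (parcs ?H)"
    proof (rule symI)
      fix x y assume "(x, y) \<in> parcs ?H"
      then obtain u v where "(u, v) \<in> parcs G" "x = f u" "y = f v" by auto
      then show "(y, x) \<in> parcs ?H" using pair_graphD(4)[OF G] by force
    qed
  qed (use pair_graphD(1-3)[OF G] in auto)
  ultimately show thesis using that isomorphic_vertex_iso[OF G] by blast
qed

text \<open>An automorphism of one copy extends by the identity on the other
  (\<open>map_sum f id\<close>), so a distinguishing colouring of the union restricts to one of
  \<open>G\<close>.\<close>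

lemma chi_D_disjoint_union_ge:
  fixes G :: "'a pair_pre_digraph"
  assumes G: "pair_graph G"
  shows "\<chi>\<^sub>D G \<le> \<chi>\<^sub>D (disjoint_union G G)"
proof -
  let ?U = "disjoint_union G G"
  have U: "pair_graph ?U" using pair_graph_disjoint_union[OF G G] .
  obtain c :: "'a + 'a \<Rightarrow> ('a + 'a) set" where c: "distinguishing ?U c" "card (c ` pverts ?U) = \<chi>\<^sub>D ?U"
    by (rule chi_D_attained[OF U])
  have "distinguishing G (c \<circ> Inl)"
    unfolding distinguishing_def
  proof (intro conjI allI impI)
    show "\<forall>(u, v) \<in> parcs G. (c \<circ> Inl) u \<noteq> (c \<circ> Inl) v"
    proof safe
      fix u v assume "(u, v) \<in> parcs G" and eq: "(c \<circ> Inl) u = (c \<circ> Inl) v"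
      then have "(Inl u, Inl v) \<in> parcs ?U" by simp
      then show False using c(1) eq unfolding distinguishing_def by fastforce
    qed
    fix f assume f: "vertex_iso f G G" "\<forall>v \<in> pverts G. (c \<circ> Inl) (f v) = (c \<circ> Inl) v"
    have "map_sum f id ` pverts ?U = pverts ?U"
      using arg_cong[OF vertex_isoD(4)[OF f(1)], of "image (Inl :: 'a \<Rightarrow> 'a + 'a)"]
      by (simp add: image_Un image_image)
    moreover have "inj_on (map_sum f id) (pverts ?U)"
    proof (rule inj_onI)
      fix a b assume "a \<in> pverts ?U" "b \<in> pverts ?U" "map_sum f id a = map_sum f id b"
      then show "a = b" using inj_onD[OF vertex_isoD(3)[OF f(1)]] by (cases a; cases b) auto
    qed
    moreover have "(map_sum f id u, map_sum f id v) \<in> parcs ?U \<longleftrightarrow> (u, v) \<in> parcs ?U"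
      if "u \<in> pverts ?U" "v \<in> pverts ?U" for u v
      using that vertex_isoD(2)[OF f(1)] by auto
    ultimately have "vertex_iso (map_sum f id) ?U ?U"
      unfolding vertex_iso_def bij_betw_def by blast
    moreover have "\<forall>v \<in> pverts ?U. c (map_sum f id v) = c v" using f(2) by auto
    ultimately have fixes_all: "\<forall>v \<in> pverts ?U. map_sum f id v = v"
      using c(1) unfolding distinguishing_def by blast
    show "\<forall>v \<in> pverts G. f v = v"
    proof
      fix v assume "v \<in> pverts G"
      then show "f v = v" using bspec[OF fixes_all, of "Inl v"] by simp
    qed
  qed
  then have "\<chi>\<^sub>D G \<le> card ((c \<circ> Inl) ` pverts G)" by (rule chi_D_le[OF G])
  also have "\<dots> \<le> card (c ` pverts ?U)"
    using pair_graphD(1)[OF U] by (intro card_mono) auto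
  finally show ?thesis using c(2) by simp
qed

section \<open>Graphs with distinguishing chromatic number one less than the order\<close>

lemma distinguishingI:
  assumes "\<And>u v. (u, v) \<in> parcs G \<Longrightarrow> c u \<noteq> c v"
    and "\<And>f v. vertex_iso f G G \<Longrightarrow> (\<And>v. v \<in> pverts G \<Longrightarrow> c (f v) = c v) \<Longrightarrow> v \<in> pverts G \<Longrightarrow> f v = v"
  shows "distinguishing G c"
  using assms by (auto simp: distinguishing_def)

lemma distinguishingD:
  assumes "distinguishing G c"
  shows "(u, v) \<in> parcs G \<Longrightarrow> c u \<noteq> c v"
    and "vertex_iso f G G \<Longrightarrow> (\<And>v. v \<in> pverts G \<Longrightarrow> c (f v) = c v) \<Longrightarrow> v \<in> pverts G \<Longrightarrow> f v = v"
  using assms by (auto simp: distinguishing_def)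

definition twins :: "'a pair_pre_digraph \<Rightarrow> 'a \<Rightarrow> 'a \<Rightarrow> bool" where
  "twins G u v \<longleftrightarrow> (\<forall>w \<in> pverts G. (u, w) \<in> parcs G \<longleftrightarrow> (v, w) \<in> parcs G)"

text \<open>These are the pairs that can share a colour: the ends are not adjacent, and the
  transposition of the two is not an automorphism.\<close>

definition bad :: "'a pair_pre_digraph \<Rightarrow> 'a \<Rightarrow> 'a \<Rightarrow> bool" where
  "bad G u v \<longleftrightarrow> u \<in> pverts G \<and> v \<in> pverts G \<and> (u, v) \<notin> parcs G \<and> \<not> twins G u v"

lemma badD:
  assumes "bad G u v"
  shows "u \<in> pverts G" "v \<in> pverts G" "(u, v) \<notin> parcs G" "\<not> twins G u v" "u \<noteq> v"
  using assms by (auto simp: bad_def twins_def)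

lemma adj_sym: "pair_graph G \<Longrightarrow> (u, v) \<in> parcs G \<longleftrightarrow> (v, u) \<in> parcs G"
  by (auto dest: pair_graphD(4))

lemma twins_sym: "twins G u v \<longleftrightarrow> twins G v u"
  by (auto simp: twins_def)

lemma bad_sym: "pair_graph G \<Longrightarrow> bad G u v \<longleftrightarrow> bad G v u"
  using adj_sym[of G u v] twins_sym[of G u v] by (auto simp: bad_def)

lemma badI:
  assumes "pair_graph G" "u \<in> pverts G" "v \<in> pverts G" "(u, v) \<notin> parcs G"
    and "(u, w) \<in> parcs G" "(v, w) \<notin> parcs G"
  shows "bad G u v"
proof -
  have "w \<in> pverts G" using pair_graphD(3)[OF assms(1,5)] .
  then show ?thesis using assms(2-6) by (auto simp: bad_def twins_def)
qed

text \<open>With fewer than \<open>n\<close> colours, two vertices share a colour. If they were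
  twins, their transposition would be a colour-preserving automorphism other than the
  identity.\<close>

lemma ex_bad:
  fixes G :: "'a pair_pre_digraph"
  assumes G: "pair_graph G" and chi: "\<chi>\<^sub>D G < card (pverts G)"
  shows "\<exists>u v. bad G u v"
proof -
  obtain c :: "'a \<Rightarrow> 'a set" where c: "distinguishing G c" "card (c ` pverts G) = \<chi>\<^sub>D G"
    by (rule chi_D_attained[OF G])
  then have "\<not> inj_on c (pverts G)" using chi card_image[of c "pverts G"] by auto
  then obtain u v where uv: "u \<in> pverts G" "v \<in> pverts G" "u \<noteq> v" "c u = c v"
    by (auto simp: inj_on_def)
  then have nadj: "(u, v) \<notin> parcs G" "(v, u) \<notin> parcs G"
    using c(1) by (auto simp: distinguishing_def)
  have "\<not> twins G u v"
  proof
    assume tw: "twins G u v"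
    let ?f = "\<lambda>w. if w = u then v else if w = v then u else w"
    have tw': "(w, u) \<in> parcs G \<longleftrightarrow> (w, v) \<in> parcs G" if "w \<in> pverts G" for w
      using tw that adj_sym[OF G, of w] by (simp add: twins_def)
    have "bij_betw ?f (pverts G) (pverts G)"
      by (rule bij_betw_byWitness[where f' = ?f]) (use uv in auto)
    moreover have left: "(?f p, r) \<in> parcs G \<longleftrightarrow> (p, r) \<in> parcs G" if "r \<in> pverts G" for p r
      using tw that by (simp add: twins_def)
    moreover have "(?f p, ?f q) \<in> parcs G \<longleftrightarrow> (p, q) \<in> parcs G"
      if pq: "p \<in> pverts G" "q \<in> pverts G" for p q
    proof -
      have "?f q \<in> pverts G" using uv pq by auto
      then have "(?f p, ?f q) \<in> parcs G \<longleftrightarrow> (p, ?f q) \<in> parcs G" by (rule left)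
      also have "\<dots> \<longleftrightarrow> (p, q) \<in> parcs G" using tw'[OF pq(1)] by simp
      finally show ?thesis .
    qed
    ultimately have "vertex_iso ?f G G" unfolding vertex_iso_def by blast
    then have "?f u = u"
      by (rule distinguishingD(2)[OF c(1)]) (use uv in auto)
    then show False using uv(3) by simp
  qed
  then show ?thesis using uv nadj by (auto simp: bad_def)
qed


text \<open>A vertex \<open>w\<close> outside \<open>S\<close> is fixed, so \<open>f\<close> carries
  the pair \<open>(a, w)\<close> to \<open>(f a, w)\<close>; inside the independent set
  \<open>S\<close> neither \<open>a\<close> nor \<open>f a\<close> has a neighbour. This is what
  makes moving a merged vertex contradict badness.\<close>

lemma twins_of_vertex_iso:
  assumes f: "vertex_iso f G G" and S: "S \<subseteq> pverts G" "\<And>p q. p \<in> S \<Longrightarrow> q \<in> S \<Longrightarrow> (p, q) \<notin> parcs G"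
    and fix_outside: "\<And>w. w \<in> pverts G \<Longrightarrow> w \<notin> S \<Longrightarrow> f w = w"
    and a: "a \<in> S" "f a \<in> S"
  shows "twins G a (f a)"
  unfolding twins_def
proof
  fix w assume w: "w \<in> pverts G"
  show "(a, w) \<in> parcs G \<longleftrightarrow> (f a, w) \<in> parcs G"
  proof (cases "w \<in> S")
    case True
    then show ?thesis using S(2) a by blast
  next
    case False
    then show ?thesis using vertex_isoD(2)[OF f, of a w] fix_outside[OF w] a S(1) w by auto
  qed
qed

section \<open>What colourings with \<open>n - 2\<close> colours forbid\<close>

text \<open>All three vertices receive one colour and the rest stay distinct. A colour-preserving
  automorphism can only permute the triple, and any vertex it moved would be a twin of its image,
  against badness.\<close>

lemma chi_D_le_bad_triangle:
  assumes G: "pair_graph G" and b: "bad G u v" "bad G v w" "bad G u w"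
  shows "\<chi>\<^sub>D G \<le> card (pverts G) - 2"
proof -
  let ?S = "{u, v, w}"
  let ?c = "\<lambda>z. if z \<in> {u, v} then w else z"
  note b' = b b[THEN bad_sym[OF G, THEN iffD1]]
  have S: "?S \<subseteq> pverts G" using b by (auto dest: badD)
  have ind: "(p, q) \<notin> parcs G" if "p \<in> ?S" "q \<in> ?S" for p q
    using that b'[THEN badD(3)] pair_graphD(5)[OF G] by auto
  have nt: "p = q" if "p \<in> ?S" "q \<in> ?S" "twins G p q" for p q
    using that b'[THEN badD(4)] by auto
  have "distinguishing G ?c"
  proof (rule distinguishingI)
    show "?c p \<noteq> ?c q" if pq: "(p, q) \<in> parcs G" for p q
    proof
      assume "?c p = ?c q"
      then have "p = q \<or> (p \<in> ?S \<and> q \<in> ?S)" by (auto split: if_splits)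
      then show False using pq ind pair_graphD(5)[OF G] by blast
    qed
    fix f z assume f: "vertex_iso f G G" "\<And>v. v \<in> pverts G \<Longrightarrow> ?c (f v) = ?c v" and z: "z \<in> pverts G"
    have out: "f z = z" if "z \<in> pverts G" "z \<notin> ?S" for z
      using f(2)[OF that(1)] that(2) by (auto split: if_splits)
    have ins: "f z \<in> ?S" if "z \<in> ?S" for z
      using f(2)[of z] that S by (auto split: if_splits)
    show "f z = z"
    proof (cases "z \<in> ?S")
      case True
      then show ?thesis using twins_of_vertex_iso[OF f(1) S ind out] ins nt by metis
    qed (use out z in blast)
  qed
  then have "\<chi>\<^sub>D G \<le> card (?c ` pverts G)" by (rule chi_D_le[OF G])
  also have "\<dots> \<le> card (pverts G - {u, v})"
    using b' pair_graphD(1)[OF G] by (intro card_mono) (auto dest: badD)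
  also have "\<dots> = card (pverts G) - 2"
    using b' pair_graphD(1)[OF G] by (subst card_Diff_subset) (auto dest: badD)
  finally show ?thesis .
qed

text \<open>Merging both pairs uses at most \<open>n - 2\<close> colours, so this colouring is not
  distinguishing, and some nontrivial automorphism permutes each pair and fixes the rest. Were only
  one pair exchanged, its ends would be twins; hence both are exchanged.\<close>

lemma swap_disjoint_bad_pairs:
  assumes G: "pair_graph G" and chi: "card (pverts G) - 2 < \<chi>\<^sub>D G"
    and b: "bad G u x" "bad G v y" and dj: "u \<noteq> v" "u \<noteq> y" "x \<noteq> v" "x \<noteq> y"
  shows "\<exists>f. vertex_iso f G G \<and> f u = x \<and> f x = u \<and> f v = y \<and> f y = v \<and>
    (\<forall>w \<in> pverts G. w \<notin> {u, x, v, y} \<longrightarrow> f w = w)"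
proof (rule ccontr)
  assume contr: "\<not> ?thesis"
  \<comment> \<open>The colours \<open>u\<close> and \<open>v\<close> are saved: \<open>u\<close>
    borrows \<open>x\<close> and \<open>v\<close> borrows \<open>y\<close>.\<close>
  let ?c = "\<lambda>z. if z = u then x else if z = v then y else z"
  note V = badD(1,2)[OF b(1)] badD(1,2)[OF b(2)]
  have ne: "u \<noteq> x" "v \<noteq> y" using b by (auto dest: badD)
  have nadj: "(u, x) \<notin> parcs G" "(x, u) \<notin> parcs G" "(v, y) \<notin> parcs G" "(y, v) \<notin> parcs G"
    using badD(3)[OF b(1)] badD(3)[OF b(2)] adj_sym[OF G] by metis+
  have "distinguishing G ?c"
  proof (rule distinguishingI)
    show "?c p \<noteq> ?c q" if pq: "(p, q) \<in> parcs G" for p q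
    proof
      assume "?c p = ?c q"
      then show False using pq nadj dj pair_graphD(5)[OF G] by (auto split: if_splits)
    qed
    fix f z assume f: "vertex_iso f G G" "\<And>v. v \<in> pverts G \<Longrightarrow> ?c (f v) = ?c v" and z: "z \<in> pverts G"
    have out: "f z = z" if "z \<in> pverts G" "z \<notin> {u, x, v, y}" for z
      using f(2)[OF that(1)] that(2) by (auto split: if_splits)
    have ux: "f u \<in> {u, x}" "f x \<in> {u, x}"
      using f(2)[OF V(1)] f(2)[OF V(2)] dj ne by (auto split: if_splits)
    have vy: "f v \<in> {v, y}" "f y \<in> {v, y}"
      using f(2)[OF V(3)] f(2)[OF V(4)] dj ne by (auto split: if_splits)
    have inj: "f u \<noteq> f x" "f v \<noteq> f y"
      using vertex_isoD(3)[OF f(1)] V ne by (auto dest: inj_onD)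
    have "f u = u \<or> f v = v"
    proof (rule ccontr)
      assume "\<not> ?thesis"
      then have "f u = x" "f x = u" "f v = y" "f y = v" using ux vy inj by auto
      then show False using contr f(1) out by blast
    qed
    moreover have "f u = u" if fv: "f v = v"
    proof (rule ccontr)
      assume "f u \<noteq> u"
      then have "f u = x" "f y = y" using ux vy inj fv by auto
      then have "twins G u (f u)"
        using f out fv nadj V pair_graphD(5)[OF G]
        by (intro twins_of_vertex_iso[where S = "{u, x}"]) auto
      then show False using badD(4)[OF b(1)] \<open>f u = x\<close> by simp
    qed
    moreover have "f v = v" if fu: "f u = u"
    proof (rule ccontr)
      assume "f v \<noteq> v"
      then have "f v = y" "f x = x" using ux vy inj fu by auto
      then have "twins G v (f v)"
        using f out fu nadj V pair_graphD(5)[OF G]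
        by (intro twins_of_vertex_iso[where S = "{v, y}"]) auto
      then show False using badD(4)[OF b(2)] \<open>f v = y\<close> by simp
    qed
    ultimately have "f u = u" "f v = v" by blast+
    then show "f z = z" using out[OF z] ux vy inj by auto
  qed
  then have "\<chi>\<^sub>D G \<le> card (?c ` pverts G)" by (rule chi_D_le[OF G])
  also have "\<dots> \<le> card (pverts G - {u, v})"
    using V dj ne pair_graphD(1)[OF G] by (intro card_mono) auto
  also have "\<dots> = card (pverts G) - 2"
    using V dj pair_graphD(1)[OF G] by (subst card_Diff_subset) auto
  finally show False using chi by simp
qed

text \<open>Read off from the simultaneous exchange. Since it fixes all other vertices, only
  \<open>v\<close> or \<open>y\<close> can tell \<open>u\<close> and \<open>x\<close> apart.\<close>

lemma disjoint_bad_pairs_adj: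
  assumes G: "pair_graph G" and chi: "card (pverts G) - 2 < \<chi>\<^sub>D G"
    and b: "bad G u x" "bad G v y" and dj: "u \<noteq> v" "u \<noteq> y" "x \<noteq> v" "x \<noteq> y"
  shows "w \<in> pverts G \<Longrightarrow> w \<notin> {u, x, v, y} \<Longrightarrow> (u, w) \<in> parcs G \<longleftrightarrow> (x, w) \<in> parcs G"
    and "(u, v) \<in> parcs G \<longleftrightarrow> (x, y) \<in> parcs G"
    and "(u, y) \<in> parcs G \<longleftrightarrow> (x, v) \<in> parcs G"
proof -
  obtain f where f: "vertex_iso f G G" "f u = x" "f x = u" "f v = y" "f y = v"
    and out: "\<forall>w \<in> pverts G. w \<notin> {u, x, v, y} \<longrightarrow> f w = w"
    using swap_disjoint_bad_pairs[OF assms] by blast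
  note V = badD(1,2)[OF b(1)] badD(1,2)[OF b(2)]
  show "w \<in> pverts G \<Longrightarrow> w \<notin> {u, x, v, y} \<Longrightarrow> (u, w) \<in> parcs G \<longleftrightarrow> (x, w) \<in> parcs G"
    using vertex_isoD(2)[OF f(1) V(1), of w] f(2) out by auto
  show "(u, v) \<in> parcs G \<longleftrightarrow> (x, y) \<in> parcs G"
    using vertex_isoD(2)[OF f(1) V(1,3)] f(2,4) by simp
  show "(u, y) \<in> parcs G \<longleftrightarrow> (x, v) \<in> parcs G"
    using vertex_isoD(2)[OF f(1) V(1,4)] f(2,5) by simp
qed

text \<open>If \<open>u\<close> and \<open>w\<close> are adjacent and \<open>v\<close> is adjacent
  to neither, then \<open>w\<close> separates \<open>u\<close> from \<open>v\<close>, so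
  \<open>u\<close> and \<open>v\<close> form a bad pair.\<close>

lemma nonadj_trans_no_bad:
  assumes G: "pair_graph G" and X: "X \<subseteq> pverts G" "\<And>u v. u \<in> X \<Longrightarrow> v \<in> X \<Longrightarrow> \<not> bad G u v"
  shows "nonadj_trans (induced G X)"
  unfolding nonadj_trans_def
proof (intro ballI impI)
  fix u v w
  assume "u \<in> pverts (induced G X)" "v \<in> pverts (induced G X)" "w \<in> pverts (induced G X)"
    "(u, w) \<in> parcs (induced G X)"
  then have *: "u \<in> X" "v \<in> X" "w \<in> X" "(u, w) \<in> parcs G" by simp_all
  then have "\<not> bad G u v" "u \<in> pverts G" "v \<in> pverts G" using X by auto
  then have "(u, v) \<in> parcs G \<or> (v, w) \<in> parcs G" using badI[OF G _ _ _ *(4)] by blast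
  then show "(u, v) \<in> parcs (induced G X) \<or> (v, w) \<in> parcs (induced G X)"
    using * by simp
qed

section \<open>The two possible structures of \<open>G\<close>\<close>

text \<open>The two copies of \<open>K2\<close> are \<open>u v\<close> and \<open>x y\<close>. The
  set \<open>M\<close> may be empty, so that \<open>2K2\<close> itself is covered.\<close>

definition join_2K2 :: "'a pair_pre_digraph \<Rightarrow> 'a set \<Rightarrow> 'a \<Rightarrow> 'a \<Rightarrow> 'a \<Rightarrow> 'a \<Rightarrow> bool" where
  "join_2K2 G M u v x y \<longleftrightarrow> distinct [u, v, x, y] \<and>
     pverts G = M \<union> {u, v, x, y} \<and> M \<inter> {u, v, x, y} = {} \<and>
     (\<forall>m \<in> M. \<forall>z \<in> {u, v, x, y}. (m, z) \<in> parcs G) \<and>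
     (u, v) \<in> parcs G \<and> (x, y) \<in> parcs G \<and>
     (u, x) \<notin> parcs G \<and> (u, y) \<notin> parcs G \<and> (v, x) \<notin> parcs G \<and> (v, y) \<notin> parcs G \<and>
     nonadj_trans (induced G M)"

text \<open>\<open>L\<close> carries \<open>H\<close> and \<open>u\<close> is the isolated vertex
  \<open>K1\<close>; the arc inside \<open>L\<close> encodes at least two parts. An empty
  \<open>R\<close> stands for \<open>H \<union> K1\<close> without a join.\<close>

definition join_isolated :: "'a pair_pre_digraph \<Rightarrow> 'a set \<Rightarrow> 'a set \<Rightarrow> 'a \<Rightarrow> bool" where
  "join_isolated G R L u \<longleftrightarrow>
     pverts G = R \<union> insert u L \<and> R \<inter> insert u L = {} \<and> u \<notin> L \<and>
     (\<forall>r \<in> R. \<forall>z \<in> insert u L. (r, z) \<in> parcs G) \<and> (\<forall>l \<in> L. (l, u) \<notin> parcs G) \<and>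
     nonadj_trans (induced G R) \<and> nonadj_trans (induced G L) \<and> parcs (induced G L) \<noteq> {}"

text \<open>Here \<open>v\<close> separates \<open>u\<close> from \<open>x\<close>. The exchange
  then makes \<open>u v\<close> and \<open>x y\<close> the only edges among the four vertices, and
  it remains to show that all other vertices are joined to these four and contain no bad
  pair.\<close>

lemma join_2K2_of_disjoint_bad_pairs:
  assumes G: "pair_graph G" and chi: "card (pverts G) - 2 < \<chi>\<^sub>D G"
    and b: "bad G u x" "bad G v y" and dj: "u \<noteq> v" "u \<noteq> y" "x \<noteq> v" "x \<noteq> y"
    and uv: "(u, v) \<in> parcs G" and xv: "(x, v) \<notin> parcs G"
  shows "join_2K2 G (pverts G - {u, v, x, y}) u v x y"
proof -
  let ?M = "pverts G - {u, v, x, y}"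
  note V = badD(1,2)[OF b(1)] badD(1,2)[OF b(2)]
  note adj = disjoint_bad_pairs_adj[OF G chi]
  have ne: "u \<noteq> x" "v \<noteq> y" using b by (auto dest: badD)
  have nux: "(u, x) \<notin> parcs G" and nvy: "(v, y) \<notin> parcs G" using b by (auto dest: badD)
  have xy: "(x, y) \<in> parcs G" and uy: "(u, y) \<notin> parcs G"
    using adj(2,3)[OF b dj] uv xv by auto
  \<comment> \<open>The four vertices carry a second pairing into disjoint bad pairs. The exchanges
    for both pairings together show that all four have the same neighbours outside.\<close>
  have b2: "bad G u y" using badI[OF G V(1,4) uy uv] nvy adj_sym[OF G] by metis
  have b3: "bad G x v" using badI[OF G V(2,3) xv xy] nvy by metis
  have all: "(u, m) \<in> parcs G \<longleftrightarrow> (z, m) \<in> parcs G" if "m \<in> ?M" "z \<in> {u, v, x, y}" for m z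
  proof -
    have "(u, m) \<in> parcs G \<longleftrightarrow> (x, m) \<in> parcs G" using adj(1)[OF b dj, of m] that by auto
    moreover have "(u, m) \<in> parcs G \<longleftrightarrow> (y, m) \<in> parcs G"
      using adj(1)[OF b2 b3, of m] that dj ne by auto
    moreover have "(x, m) \<in> parcs G \<longleftrightarrow> (v, m) \<in> parcs G"
      using adj(1)[OF b3 b2, of m] that dj ne by auto
    ultimately show ?thesis using that(2) by auto
  qed
  \<comment> \<open>A vertex \<open>m\<close> not adjacent to \<open>u\<close> would be adjacent to
    none of the four. Then \<open>v\<close> separates \<open>u\<close> from \<open>m\<close> and
    \<open>y\<close> separates \<open>x\<close> from \<open>m\<close>, so \<open>u\<close>,
    \<open>x\<close>, \<open>m\<close> are pairwise bad.\<close>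
  have um: "(u, m) \<in> parcs G" if m: "m \<in> ?M" for m
  proof (rule ccontr)
    assume um: "(u, m) \<notin> parcs G"
    then have n: "(m, v) \<notin> parcs G" "(m, y) \<notin> parcs G" "(x, m) \<notin> parcs G"
      using all[OF m] adj_sym[OF G, of m] by auto
    have "bad G u m" using badI[OF G V(1) _ um uv n(1)] m by blast
    moreover have "bad G x m" using badI[OF G V(2) _ n(3) xy n(2)] m by blast
    ultimately show False using chi_D_le_bad_triangle[OF G b(1)] chi by simp
  qed
  \<comment> \<open>A bad pair outside would be disjoint from \<open>u x\<close>. Exchanging these
    two pairs fixes \<open>v\<close>, yet \<open>v\<close> separates \<open>u\<close> from
    \<open>x\<close>.\<close>
  have "\<not> bad G p q" if "p \<in> ?M" "q \<in> ?M" for p q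
  proof
    assume "bad G p q"
    then show False using adj(1)[OF b(1), of p q v] that uv xv V dj ne by auto
  qed
  then have "nonadj_trans (induced G ?M)" by (intro nonadj_trans_no_bad[OF G]) auto
  moreover have "(m, z) \<in> parcs G" if "m \<in> ?M" "z \<in> {u, v, x, y}" for m z
    using um[OF that(1)] all[OF that] adj_sym[OF G] by metis
  moreover have "(v, x) \<notin> parcs G" using xv adj_sym[OF G] by metis
  ultimately show ?thesis
    unfolding join_2K2_def using V ne dj uv xy nux uy nvy by auto
qed

text \<open>\<open>L\<close> consists of the leaves of the star and \<open>R\<close> of the
  remaining vertices. Every claim follows because a violation would create a bad pair that avoids
  the centre \<open>u\<close>.\<close>

lemma join_isolated_of_star:
  assumes G: "pair_graph G" and bl: "bad G u l" and star: "\<And>p q. bad G p q \<Longrightarrow> u \<in> {p, q}"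
  shows "\<exists>R L. join_isolated G R L u"
proof -
  define L where "L = {z. bad G u z}"
  define R where "R = pverts G - insert u L"
  have u: "u \<in> pverts G" and L: "L \<subseteq> pverts G" "u \<notin> L" "l \<in> L"
    using bl by (auto simp: L_def dest: badD)
  have nul: "(z, u) \<notin> parcs G" "(u, z) \<notin> parcs G" if "z \<in> L" for z
    using that adj_sym[OF G, of u z] by (auto simp: L_def dest: badD)
  have ru: "(r, u) \<in> parcs G" if r: "r \<in> R" for r
  proof (rule ccontr)
    assume nru: "(r, u) \<notin> parcs G"
    have rV: "r \<in> pverts G" "r \<noteq> u" and "\<not> bad G u r" using r by (auto simp: R_def L_def)
    \<comment> \<open>A vertex nonadjacent to \<open>u\<close> and not bad with it is a twin of
      \<open>u\<close>, hence inherits the bad pair with \<open>l\<close>; that pair misses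
      \<open>u\<close>.\<close>
    then have tw: "twins G u r" using u nru adj_sym[OF G, of u r] by (auto simp: bad_def)
    then have "bad G r l" using bl rV by (auto simp: bad_def twins_def)
    then show False using star rV L by blast
  qed
  have rl: "(r, z) \<in> parcs G" if r: "r \<in> R" and z: "z \<in> L" for r z
  proof (rule ccontr)
    assume "(r, z) \<notin> parcs G"
    \<comment> \<open>The separating vertex is \<open>u\<close>: it is adjacent to \<open>r\<close>
      but not to the leaf \<open>z\<close>.\<close>
    then have "bad G r z" using badI[OF G, of r z u] ru[OF r] nul(1)[OF z] r z L by (auto simp: R_def)
    then show False using star r z L by (auto simp: R_def)
  qed
  have co: "nonadj_trans (induced G X)" if "X \<subseteq> pverts G" "u \<notin> X" for X
    by (rule nonadj_trans_no_bad[OF G that(1)]) (use star that(2) in blast)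
  have "\<not> twins G u l" using bl by (rule badD)
  then obtain w where w: "w \<in> pverts G" "(u, w) \<in> parcs G \<longleftrightarrow> (l, w) \<notin> parcs G"
    by (auto simp: twins_def)
  \<comment> \<open>Vertices of \<open>R\<close> are adjacent to both \<open>u\<close> and
    \<open>l\<close>, so what separates these two is a leaf. As leaves are not adjacent to
    \<open>u\<close>, it must be adjacent to \<open>l\<close>, which gives the required arc.\<close>
  have "w \<in> L"
  proof (rule ccontr)
    assume "w \<notin> L"
    moreover have "w \<noteq> u" using w nul[OF L(3)] pair_graphD(5)[OF G] by auto
    ultimately have "w \<in> R" using w by (simp add: R_def)
    then show False using ru rl[OF _ L(3)] w(2) adj_sym[OF G] by metis
  qed
  then have "(l, w) \<in> parcs (induced G L)" using w(2) nul L by auto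
  then have "parcs (induced G L) \<noteq> {}" by (metis empty_iff)
  then have "join_isolated G R L u"
    unfolding join_isolated_def using u L ru rl nul co[of R] co[of L] by (auto simp: R_def)
  then show ?thesis by blast
qed

text \<open>Regard the bad pairs as edges of an auxiliary graph. Either two edges are disjoint, or
  all edges meet pairwise; in the latter case they form a star or a triangle, and the triangle is
  excluded by the number of colours.\<close>

lemma chi_D_pred_cases:
  assumes G: "pair_graph G" and card: "card (pverts G) \<ge> 2" and chi: "\<chi>\<^sub>D G = card (pverts G) - 1"
  shows "(\<exists>M u v x y. join_2K2 G M u v x y) \<or> (\<exists>R L u. join_isolated G R L u)"
proof -
  have chi2: "card (pverts G) - 2 < \<chi>\<^sub>D G" using card chi by linarith
  have "\<chi>\<^sub>D G < card (pverts G)" using card chi by linarith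
  then obtain a b where ab: "bad G a b" using ex_bad[OF G] by blast
  show ?thesis
  proof (cases "\<exists>u x v y. bad G u x \<and> bad G v y \<and> u \<noteq> v \<and> u \<noteq> y \<and> x \<noteq> v \<and> x \<noteq> y")
    case True
    then obtain u x v y where b: "bad G u x" "bad G v y" and dj: "u \<noteq> v" "u \<noteq> y" "x \<noteq> v" "x \<noteq> y"
      by blast
    have b': "bad G x u" "bad G y v" using b bad_sym[OF G] by metis+
    obtain w where w: "w \<in> pverts G" "(u, w) \<in> parcs G \<longleftrightarrow> (x, w) \<notin> parcs G"
      using badD(4)[OF b(1)] by (auto simp: twins_def)
    have "w \<noteq> u" "w \<noteq> x"
      using w(2) badD(3)[OF b(1)] badD(3)[OF b'(1)] pair_graphD(5)[OF G] by auto
    then have "w = v \<or> w = y"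
      using disjoint_bad_pairs_adj(1)[OF G chi2 b dj w(1)] w(2) by auto
    \<comment> \<open>Each of the four cases is the hypothesis of
      \<open>join_2K2_of_disjoint_bad_pairs\<close> after exchanging the names inside one or both
      bad pairs.\<close>
    then have "(u, v) \<in> parcs G \<and> (x, v) \<notin> parcs G \<or> (x, v) \<in> parcs G \<and> (u, v) \<notin> parcs G \<or>
        (u, y) \<in> parcs G \<and> (x, y) \<notin> parcs G \<or> (x, y) \<in> parcs G \<and> (u, y) \<notin> parcs G"
      using w(2) by auto
    then show ?thesis
      using join_2K2_of_disjoint_bad_pairs[OF G chi2] b b' dj by metis
  next
    case False
    then have meet: "p \<in> {r, s} \<or> q \<in> {r, s}" if "bad G p q" "bad G r s" for p q r s
      using that by blast
    have "\<exists>u z. bad G u z \<and> (\<forall>p q. bad G p q \<longrightarrow> u \<in> {p, q})"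
    proof (cases "\<forall>p q. bad G p q \<longrightarrow> a \<in> {p, q}")
      case True
      then show ?thesis using ab by blast
    next
      case False
      \<comment> \<open>A bad pair that misses \<open>a\<close> still meets \<open>a b\<close>, so
        it contains \<open>b\<close>, which becomes the candidate for the centre.\<close>
      then obtain d where d: "bad G b d" "d \<noteq> a"
        using meet[OF ab] bad_sym[OF G] by (metis insert_iff singletonD)
      have "b \<in> {p, q}" if pq: "bad G p q" for p q
      proof (rule ccontr)
        assume "b \<notin> {p, q}"
        \<comment> \<open>A pair missing \<open>b\<close> has to meet both \<open>a b\<close> and
          \<open>b d\<close>, so it is \<open>a d\<close> and closes a bad triangle.\<close>
        then have "a \<in> {p, q}" "d \<in> {p, q}" using meet[OF ab pq] meet[OF d(1) pq] by auto
        then have "bad G a d" using pq d(2) bad_sym[OF G] by auto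
        then show False using chi_D_le_bad_triangle[OF G ab d(1)] chi2 by simp
      qed
      then show ?thesis using d by blast
    qed
    then show ?thesis using join_isolated_of_star[OF G] by metis
  qed
qed

section \<open>Two copies of a graph\<close>

lemma vertex_iso_endoI:
  assumes G: "pair_graph G" and V: "\<And>v. v \<in> pverts G \<Longrightarrow> g v \<in> pverts G" and inj: "inj_on g (pverts G)"
    and adj: "\<And>u v. u \<in> pverts G \<Longrightarrow> v \<in> pverts G \<Longrightarrow> (g u, g v) \<in> parcs G \<longleftrightarrow> (u, v) \<in> parcs G"
  shows "vertex_iso g G G"
proof -
  have "g ` pverts G = pverts G"
    by (rule endo_inj_surj[OF pair_graphD(1)[OF G] _ inj]) (use V in auto)
  then show ?thesis using inj adj by (simp add: vertex_iso_def bij_betw_def)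
qed

lemma distinguishing_comp:
  assumes "distinguishing G c" "inj \<pi>"
  shows "distinguishing G (\<pi> \<circ> c)"
proof (rule distinguishingI)
  show "(\<pi> \<circ> c) u \<noteq> (\<pi> \<circ> c) v" if "(u, v) \<in> parcs G" for u v
    using distinguishingD(1)[OF assms(1) that] assms(2) by (auto dest: injD)
  fix f v assume "vertex_iso f G G" "\<And>v. v \<in> pverts G \<Longrightarrow> (\<pi> \<circ> c) (f v) = (\<pi> \<circ> c) v" "v \<in> pverts G"
  then show "f v = v"
    using assms(2) by (intro distinguishingD(2)[OF assms(1)]) (auto dest: injD)
qed

text \<open>A colour-preserving automorphism could at most exchange \<open>u\<close> and
  \<open>x\<close>, which would make them twins. This is the explicit colouring that is then varied
  on the second copy.\<close>

lemma distinguishing_merge_bad: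
  assumes G: "pair_graph G" and b: "bad G u x"
  shows "distinguishing G (\<lambda>z. if z = u then x else z)"
proof (rule distinguishingI)
  let ?c = "\<lambda>z. if z = u then x else z"
  have ux: "u \<in> pverts G" "x \<in> pverts G" "u \<noteq> x" using b by (auto dest: badD)
  have nadj: "(u, x) \<notin> parcs G" "(x, u) \<notin> parcs G"
    using badD(3)[OF b] adj_sym[OF G] by metis+
  show "?c p \<noteq> ?c q" if "(p, q) \<in> parcs G" for p q
    using that nadj pair_graphD(5)[OF G] by (auto split: if_splits)
  fix f z assume f: "vertex_iso f G G" "\<And>v. v \<in> pverts G \<Longrightarrow> ?c (f v) = ?c v" and z: "z \<in> pverts G"
  have out: "f z = z" if "z \<in> pverts G" "z \<notin> {u, x}" for z
    using f(2)[OF that(1)] that(2) by (auto split: if_splits)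
  have ins: "f u \<in> {u, x}" "f x \<in> {u, x}"
    using f(2)[OF ux(1)] f(2)[OF ux(2)] by (auto split: if_splits)
  have "twins G p (f p)" if "p \<in> {u, x}" for p
    by (rule twins_of_vertex_iso[OF f(1), of "{u, x}"])
      (use that ux nadj pair_graphD(5)[OF G] out ins in auto)
  then have "f u = u" "f x = x" using ins badD(4)[OF b] twins_sym by (metis insert_iff singletonD)+
  then show "f z = z" using out[OF z] by auto
qed

lemma vertex_iso_disjoint_union_isl:
  assumes f: "vertex_iso f (disjoint_union G H) (disjoint_union G' H')"
    and pq: "(p, q) \<in> parcs (disjoint_union G H)"
      "p \<in> pverts (disjoint_union G H)" "q \<in> pverts (disjoint_union G H)"
  shows "isl (f p) = isl (f q)"
proof -
  have "(f p, f q) \<in> parcs (disjoint_union G' H')" using vertex_isoD(2)[OF f pq(2,3)] pq(1) by simp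
  then show ?thesis by (cases "f p"; cases "f q") auto
qed

text \<open>Arcs stay inside a copy, so with distances at most two each copy is mapped into a single
  copy. The copies cannot be exchanged: colour \<open>x\<close> occurs on two vertices of the first
  copy and only on \<open>t\<close> in the second. With each copy preserved, the colouring of that
  copy does the rest.\<close>

lemma chi_D_double_diameter2:
  fixes G :: "'a pair_pre_digraph"
  assumes G: "pair_graph G" and b: "bad G u x" and t: "t \<in> pverts G" "t \<noteq> u" "t \<noteq> x"
    and diam: "\<And>p q. p \<in> pverts G \<Longrightarrow> q \<in> pverts G \<Longrightarrow>
      p = q \<or> (p, q) \<in> parcs G \<or> (\<exists>w. (p, w) \<in> parcs G \<and> (w, q) \<in> parcs G)"
  shows "\<chi>\<^sub>D (disjoint_union G G) \<le> card (pverts G) - 1"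
proof -
  let ?U = "disjoint_union G G"
  define c1 where "c1 = (\<lambda>z. if z = u then x else z)"
  \<comment> \<open>The third vertex \<open>t\<close> supplies a colour used once; exchanging it
    with the doubled colour \<open>x\<close> makes the two copies different without any new
    colour.\<close>
  define \<pi> where "\<pi> = (\<lambda>k. if k = x then t else if k = t then x else k)"
  define c where "c = case_sum c1 (\<pi> \<circ> c1)"
  have U: "pair_graph ?U" using pair_graph_disjoint_union[OF G G] .
  have ux: "u \<in> pverts G" "x \<in> pverts G" "u \<noteq> x" using b by (auto dest: badD)
  have c1: "distinguishing G c1" unfolding c1_def by (rule distinguishing_merge_bad[OF G b])
  have "inj \<pi>" by (rule injI) (auto simp: \<pi>_def split: if_splits)
  then have c2: "distinguishing G (\<pi> \<circ> c1)" by (rule distinguishing_comp[OF c1])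
  have c1t: "z = t" if "c1 z = t" for z using that t ux by (auto simp: c1_def split: if_splits)
  have c2x: "z = t" if "\<pi> (c1 z) = x" for z
    using that c1t[of z] t by (auto simp: \<pi>_def split: if_splits)
  have "distinguishing ?U c"
  proof (rule distinguishingI)
    show "c p \<noteq> c q" if "(p, q) \<in> parcs ?U" for p q
      using that distinguishingD(1)[OF c1, of "projl p" "projl q"]
        distinguishingD(1)[OF c2, of "projr p" "projr q"]
      by (cases p; cases q) (auto simp: c_def)
    fix f z
    assume f: "vertex_iso f ?U ?U" and pres: "\<And>v. v \<in> pverts ?U \<Longrightarrow> c (f v) = c v" and z: "z \<in> pverts ?U"
    have fU: "f p \<in> pverts ?U" if "p \<in> pverts ?U" for p using vertex_isoD(1)[OF f that] .
    have inj: "p = q" if "f p = f q" "p \<in> pverts ?U" "q \<in> pverts ?U" for p q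
      using inj_onD[OF vertex_isoD(3)[OF f] that] .
    have sideL: "isl (f (Inl p)) = isl (f (Inl q))" if pq: "p \<in> pverts G" "q \<in> pverts G" for p q
    proof -
      have "isl (f (Inl a)) = isl (f (Inl b))" if "(a, b) \<in> parcs G" for a b
        using vertex_iso_disjoint_union_isl[OF f, of "Inl a" "Inl b"] that pair_graphD(2,3)[OF G that] by simp
      then show ?thesis using diam[OF pq] by metis
    qed
    have sideR: "isl (f (Inr p)) = isl (f (Inr q))" if pq: "p \<in> pverts G" "q \<in> pverts G" for p q
    proof -
      have "isl (f (Inr a)) = isl (f (Inr b))" if "(a, b) \<in> parcs G" for a b
        using vertex_iso_disjoint_union_isl[OF f, of "Inr a" "Inr b"] that pair_graphD(2,3)[OF G that] by simp
      then show ?thesis using diam[OF pq] by metis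
    qed
    \<comment> \<open>Otherwise \<open>u\<close> and \<open>x\<close>, both of colour
      \<open>x\<close>, would both land on the only vertex of that colour in the other copy, namely
      \<open>t\<close>. The other direction is the same with colour \<open>t\<close>.\<close>
    have L: "isl (f (Inl v))" if v: "v \<in> pverts G" for v
    proof (rule ccontr)
      assume "\<not> isl (f (Inl v))"
      then have "\<not> isl (f (Inl u))" "\<not> isl (f (Inl x))" using sideL v ux by metis+
      then obtain p q where pq: "f (Inl u) = Inr p" "f (Inl x) = Inr q"
        by (metis sum.collapse(2))
      then have "\<pi> (c1 p) = x" "\<pi> (c1 q) = x"
        using pres[of "Inl u"] pres[of "Inl x"] ux by (auto simp: c_def c1_def)
      then have "p = t" "q = t" using c2x by blast+
      then show False using inj[of "Inl u" "Inl x"] pq ux by simp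
    qed
    have R: "\<not> isl (f (Inr v))" if v: "v \<in> pverts G" for v
    proof
      assume "isl (f (Inr v))"
      then have "isl (f (Inr u))" "isl (f (Inr x))" using sideR v ux by metis+
      then obtain p q where pq: "f (Inr u) = Inl p" "f (Inr x) = Inl q"
        by (metis sum.collapse(1))
      then have "c1 p = t" "c1 q = t"
        using pres[of "Inr u"] pres[of "Inr x"] ux by (auto simp: c_def c1_def \<pi>_def)
      then have "p = t" "q = t" using c1t by blast+
      then show False using inj[of "Inr u" "Inr x"] pq ux by simp
    qed
    define g1 where "g1 = (\<lambda>v. projl (f (Inl v)))"
    define g2 where "g2 = (\<lambda>v. projr (f (Inr v)))"
    have g1: "f (Inl v) = Inl (g1 v)" if "v \<in> pverts G" for v using L[OF that] by (simp add: g1_def)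
    have g2: "f (Inr v) = Inr (g2 v)" if "v \<in> pverts G" for v using R[OF that] by (simp add: g2_def)
    have "vertex_iso g1 G G"
    proof (rule vertex_iso_endoI[OF G])
      show "g1 v \<in> pverts G" if "v \<in> pverts G" for v using fU[of "Inl v"] g1[OF that] that by auto
      show "inj_on g1 (pverts G)" using inj[of "Inl _" "Inl _"] g1 by (auto intro!: inj_onI)
      show "(g1 p, g1 q) \<in> parcs G \<longleftrightarrow> (p, q) \<in> parcs G" if "p \<in> pverts G" "q \<in> pverts G" for p q
        using vertex_isoD(2)[OF f, of "Inl p" "Inl q"] g1 that by simp
    qed
    moreover have "c1 (g1 v) = c1 v" if "v \<in> pverts G" for v
      using pres[of "Inl v"] g1 that by (simp add: c_def)
    ultimately have fix1: "g1 v = v" if "v \<in> pverts G" for v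
      using distinguishingD(2)[OF c1] that by blast
    have "vertex_iso g2 G G"
    proof (rule vertex_iso_endoI[OF G])
      show "g2 v \<in> pverts G" if "v \<in> pverts G" for v using fU[of "Inr v"] g2[OF that] that by auto
      show "inj_on g2 (pverts G)" using inj[of "Inr _" "Inr _"] g2 by (auto intro!: inj_onI)
      show "(g2 p, g2 q) \<in> parcs G \<longleftrightarrow> (p, q) \<in> parcs G" if "p \<in> pverts G" "q \<in> pverts G" for p q
        using vertex_isoD(2)[OF f, of "Inr p" "Inr q"] g2 that by simp
    qed
    moreover have "(\<pi> \<circ> c1) (g2 v) = (\<pi> \<circ> c1) v" if "v \<in> pverts G" for v
      using pres[of "Inr v"] g2 that by (simp add: c_def)
    ultimately have fix2: "g2 v = v" if "v \<in> pverts G" for v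
      using distinguishingD(2)[OF c2] that by blast
    show "f z = z" using z g1 g2 fix1 fix2 by auto
  qed
  then have "\<chi>\<^sub>D ?U \<le> card (c ` pverts ?U)" by (rule chi_D_le[OF U])
  also have "\<dots> \<le> card (pverts G - {u})"
    using pair_graphD(1)[OF G] ux t by (intro card_mono) (auto simp: c_def c1_def \<pi>_def split: if_splits)
  also have "\<dots> = card (pverts G) - 1" using ux by simp
  finally show ?thesis .
qed

section \<open>Two copies of \<open>H \<union> K1\<close>\<close>

text \<open>Isolated vertices can only be permuted among themselves, and
  \<open>c1 u \<noteq> c2 u\<close> pins them. The graph on \<open>L\<close> is connected, so its
  copies are either preserved or exchanged: injectivity of the colours settles the first case, and
  \<open>asym\<close> excludes the second. The colour of \<open>u\<close> may recur on
  \<open>L\<close>, which is where a colour can be saved.\<close>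

lemma distinguishing_double_isolated:
  fixes G :: "'a pair_pre_digraph"
  assumes G: "pair_graph G" and V: "pverts G = insert u L" "u \<notin> L"
    and iso: "\<And>l. l \<in> L \<Longrightarrow> (l, u) \<notin> parcs G"
    and co: "nonadj_trans (induced G L)" and ne: "parcs (induced G L) \<noteq> {}"
    and inj1: "inj_on c1 L" and inj2: "inj_on c2 L" and cu: "c1 u \<noteq> c2 u"
    and asym: "\<And>\<sigma>. (\<And>l. l \<in> L \<Longrightarrow> \<sigma> l \<in> L \<and> c2 (\<sigma> l) = c1 l) \<Longrightarrow>
      (\<And>l m. l \<in> L \<Longrightarrow> m \<in> L \<Longrightarrow> (\<sigma> l, \<sigma> m) \<in> parcs G \<longleftrightarrow> (l, m) \<in> parcs G) \<Longrightarrow> False"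
  shows "distinguishing (disjoint_union G G) (case_sum c1 c2)"
proof (rule distinguishingI)
  let ?U = "disjoint_union G G" and ?c = "case_sum c1 c2"
  have co': "(p, q) \<in> parcs G \<or> (q, r) \<in> parcs G"
    if "p \<in> L" "q \<in> L" "r \<in> L" "(p, r) \<in> parcs G" for p q r
    using co that by (fastforce simp: nonadj_trans_def)
  have inL: "p \<in> L" "q \<in> L" if "(p, q) \<in> parcs G" for p q
  proof -
    have "p \<in> insert u L" "q \<in> insert u L" using pair_graphD(2,3)[OF G that] V(1) by auto
    moreover have "p \<noteq> q" using pair_graphD(5)[OF G] that by auto
    ultimately show "p \<in> L" "q \<in> L"
      using iso[of p] iso[of q] that pair_graphD(4)[OF G that] by auto
  qed
  have nu: "(u, q) \<notin> parcs G" for q using inL V(2) by blast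
  obtain a b where ab: "(a, b) \<in> parcs G" using ne by auto
  \<comment> \<open>Transitivity of nonadjacency makes every vertex of \<open>L\<close> adjacent to
    an end of the arc \<open>a b\<close>. The same argument at a neighbour of \<open>p\<close> then
    bounds distances in \<open>L\<close> by two.\<close>
  have nbr: "\<exists>m \<in> L. (l, m) \<in> parcs G" if "l \<in> L" for l
    using co'[OF inL(1)[OF ab] that inL(2)[OF ab] ab] inL[OF ab] adj_sym[OF G] by metis
  have diam: "p = q \<or> (p, q) \<in> parcs G \<or> (\<exists>w. (p, w) \<in> parcs G \<and> (w, q) \<in> parcs G)"
    if "p \<in> L" "q \<in> L" for p q
    using nbr[OF that(1)] co' that adj_sym[OF G] by metis
  show "?c p \<noteq> ?c q" if pq: "(p, q) \<in> parcs ?U" for p q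
  proof (cases p; cases q)
    fix p' q' assume "p = Inl p'" "q = Inl q'"
    then show ?thesis using pq inL[of p' q'] pair_graphD(5)[OF G] inj_onD[OF inj1] by fastforce
  next
    fix p' q' assume "p = Inr p'" "q = Inr q'"
    then show ?thesis using pq inL[of p' q'] pair_graphD(5)[OF G] inj_onD[OF inj2] by fastforce
  qed (use pq in auto)
  fix f z
  assume f: "vertex_iso f ?U ?U" and pres: "\<And>v. v \<in> pverts ?U \<Longrightarrow> ?c (f v) = ?c v" and z: "z \<in> pverts ?U"
  have fU: "f p \<in> pverts ?U" if "p \<in> pverts ?U" for p using vertex_isoD(1)[OF f that] .
  have adj: "(f p, f q) \<in> parcs ?U \<longleftrightarrow> (p, q) \<in> parcs ?U" if "p \<in> pverts ?U" "q \<in> pverts ?U" for p q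
    using vertex_isoD(2)[OF f that] .
  have inj: "p = q" if "f p = f q" "p \<in> pverts ?U" "q \<in> pverts ?U" for p q
    using inj_onD[OF vertex_isoD(3)[OF f] that] .
  have isolated: "(p, q) \<notin> parcs ?U" if "p \<in> {Inl u, Inr u}" for p q
    using that nu by (cases q) auto
  have f_iso: "f p \<in> {Inl u, Inr u}" if p: "p \<in> {Inl u, Inr u}" for p
  proof (rule ccontr)
    assume np: "f p \<notin> {Inl u, Inr u}"
    have pU: "p \<in> pverts ?U" using p V by auto
    then have "f p \<in> Inl ` L \<union> Inr ` L" using fU[OF pU] np V by auto
    then obtain l where l: "l \<in> L" "f p = Inl l \<or> f p = Inr l" by blast
    obtain k where k: "k \<in> L" "(l, k) \<in> parcs G" using nbr[OF l(1)] by blast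
    then have "\<exists>q. q \<in> pverts ?U \<and> (f p, q) \<in> parcs ?U"
      using l(2)
    proof (elim disjE)
      show ?thesis if "f p = Inl l" using k V(1) that by (intro exI[of _ "Inl k"]) simp
      show ?thesis if "f p = Inr l" using k V(1) that by (intro exI[of _ "Inr k"]) simp
    qed
    \<comment> \<open>The neighbour of \<open>f p\<close> is itself an image under \<open>f\<close>;
      pulling the arc back gives the isolated vertex \<open>p\<close> a neighbour.\<close>
    then obtain q where q: "q \<in> pverts ?U" "(f p, q) \<in> parcs ?U" by blast
    then obtain q' where "q' \<in> pverts ?U" "q = f q'" using vertex_isoD(4)[OF f] by blast
    then show False using adj[OF pU] q isolated[OF p] by auto
  qed
  have fl: "f (Inl u) = Inl u" using f_iso[of "Inl u"] pres[of "Inl u"] cu V by auto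
  have fr: "f (Inr u) = Inr u" using f_iso[of "Inr u"] pres[of "Inr u"] cu V by auto
  have stay: "f p \<in> Inl ` L \<union> Inr ` L" if "p \<in> Inl ` L \<union> Inr ` L" for p
  proof -
    have "p \<in> pverts ?U" "p \<noteq> Inl u" "p \<noteq> Inr u" using that V by auto
    then have "f p \<in> pverts ?U" "f p \<noteq> Inl u" "f p \<noteq> Inr u"
      using fU inj[of p "Inl u"] inj[of p "Inr u"] fl fr V by auto
    then show ?thesis using V by auto
  qed
  have side: "isl (f (Inl p)) = isl (f (Inl q))" if pq: "p \<in> L" "q \<in> L" for p q
  proof -
    have "isl (f (Inl a)) = isl (f (Inl b))" if "(a, b) \<in> parcs G" for a b
      using vertex_iso_disjoint_union_isl[OF f, of "Inl a" "Inl b"] that pair_graphD(2,3)[OF G that] by simp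
    then show ?thesis using diam[OF pq] by metis
  qed
  have isl: "isl (f (Inl l))" if l: "l \<in> L" for l
  proof (rule ccontr)
    assume "\<not> isl (f (Inl l))"
    then have "\<not> isl (f (Inl m))" if "m \<in> L" for m using side[OF that l] by simp
    then have \<sigma>: "f (Inl m) = Inr (projr (f (Inl m)))" if "m \<in> L" for m using that by simp
    define \<sigma> where "\<sigma> m = projr (f (Inl m))" for m
    have \<sigma>: "f (Inl m) = Inr (\<sigma> m)" if "m \<in> L" for m unfolding \<sigma>_def by (rule \<sigma>[OF that])
    show False
    proof (rule asym)
      show "\<sigma> m \<in> L \<and> c2 (\<sigma> m) = c1 m" if "m \<in> L" for m
        using stay[of "Inl m"] pres[of "Inl m"] \<sigma>[OF that] that V by auto
      show "(\<sigma> m, \<sigma> k) \<in> parcs G \<longleftrightarrow> (m, k) \<in> parcs G" if "m \<in> L" "k \<in> L" for m k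
        using adj[of "Inl m" "Inl k"] \<sigma> that V by simp
    qed
  qed
  have fL: "f (Inl l) = Inl l" if l: "l \<in> L" for l
  proof -
    obtain m where m: "f (Inl l) = Inl m" "m \<in> L" using isl[OF l] stay[of "Inl l"] l by auto
    then have "c1 m = c1 l" using pres[of "Inl l"] l V by simp
    then show ?thesis using m l inj_onD[OF inj1] by simp
  qed
  have fR: "f (Inr l) = Inr l" if l: "l \<in> L" for l
  proof -
    \<comment> \<open>The first copy of \<open>L\<close> is already fixed pointwise, so injectivity
      keeps the second copy away from it.\<close>
    have "f (Inr l) \<noteq> Inl m" if "m \<in> L" for m
      using inj[of "Inr l" "Inl m"] fL[OF that] l that V by auto
    then obtain m where m: "f (Inr l) = Inr m" "m \<in> L" using stay[of "Inr l"] l by auto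
    then have "c2 m = c2 l" using pres[of "Inr l"] l V by simp
    then show ?thesis using m l inj_onD[OF inj2] by simp
  qed
  show "f z = z" using z V fl fr fL fR by auto
qed

text \<open>The second copy exchanges the colours of \<open>b\<close> and \<open>d\<close>, where
  \<open>d\<close> is adjacent to \<open>a\<close> and \<open>b\<close> is not. An exchange of the
  copies respecting colours would have to send \<open>a\<close> to \<open>a\<close> and
  \<open>b\<close> to \<open>d\<close>, turning a nonadjacent pair into an adjacent one. The
  isolated vertices borrow the different colours \<open>a\<close> and \<open>b\<close>, so only
  colours from \<open>L\<close> occur.\<close>

lemma chi_D_double_isolated_noncomplete:
  fixes G :: "'a pair_pre_digraph"
  assumes G: "pair_graph G" and V: "pverts G = insert u L" "u \<notin> L"
    and iso: "\<And>l. l \<in> L \<Longrightarrow> (l, u) \<notin> parcs G"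
    and co: "nonadj_trans (induced G L)" and ne: "parcs (induced G L) \<noteq> {}"
    and ab: "a \<in> L" "b \<in> L" "a \<noteq> b" "(a, b) \<notin> parcs G"
  shows "\<chi>\<^sub>D (disjoint_union G G) \<le> card L"
proof -
  let ?U = "disjoint_union G G"
  obtain p q where pq: "p \<in> L" "q \<in> L" "(p, q) \<in> parcs G" using ne by auto
  have "(p, a) \<in> parcs G \<or> (a, q) \<in> parcs G"
    using co pq ab(1) by (auto simp: nonadj_trans_def)
  then obtain d where d: "d \<in> L" "(a, d) \<in> parcs G" using pq adj_sym[OF G, of a p] by blast
  define \<pi> where "\<pi> k = (if k = b then d else if k = d then b else k)" for k
  define c1 where "c1 k = (if k = u then a else k)" for k
  define c2 where "c2 k = (if k = u then b else \<pi> k)" for k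
  have \<pi>\<pi>: "\<pi> (\<pi> k) = k" for k by (simp add: \<pi>_def)
  have "distinguishing ?U (case_sum c1 c2)"
  proof (rule distinguishing_double_isolated[OF G V iso co ne])
    show "inj_on c1 L" "inj_on c2 L" "c1 u \<noteq> c2 u"
      using V(2) ab(3) by (auto simp: inj_on_def c1_def c2_def \<pi>_def)
    fix \<sigma> assume s: "\<And>l. l \<in> L \<Longrightarrow> \<sigma> l \<in> L \<and> c2 (\<sigma> l) = c1 l"
      and adj: "\<And>l m. l \<in> L \<Longrightarrow> m \<in> L \<Longrightarrow> (\<sigma> l, \<sigma> m) \<in> parcs G \<longleftrightarrow> (l, m) \<in> parcs G"
    have "\<sigma> l = \<pi> l" if "l \<in> L" for l
    proof -
      have "\<sigma> l \<noteq> u" "l \<noteq> u" "c2 (\<sigma> l) = c1 l" using s[OF that] that V(2) by auto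
      then have "\<pi> (\<sigma> l) = l" by (simp add: c1_def c2_def)
      then show ?thesis using \<pi>\<pi>[of "\<sigma> l"] by simp
    qed
    moreover have "a \<noteq> d" using d(2) pair_graphD(5)[OF G] by auto
    ultimately have "\<sigma> a = a" "\<sigma> b = d" using ab by (auto simp: \<pi>_def)
    then show False using adj[OF ab(1,2)] ab(4) d(2) by simp
  qed
  then have "\<chi>\<^sub>D ?U \<le> card (case_sum c1 c2 ` pverts ?U)"
    by (rule chi_D_le[OF pair_graph_disjoint_union[OF G G]])
  also have "\<dots> \<le> card L"
  proof (rule card_mono)
    show "finite L" using pair_graphD(1)[OF G] V by simp
    show "case_sum c1 c2 ` pverts ?U \<subseteq> L"
      using V ab d by (auto simp: c1_def c2_def \<pi>_def)
  qed
  finally show ?thesis .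
qed

text \<open>With one more colour no nonadjacent pair is needed: the colour \<open>p\<close> occurs
  on \<open>L\<close> in the first copy, but in the second copy only on the isolated vertex, so the
  copies of \<open>L\<close> cannot be exchanged.\<close>

lemma chi_D_double_isolated_le:
  fixes G :: "'a pair_pre_digraph"
  assumes G: "pair_graph G" and V: "pverts G = insert u L" "u \<notin> L"
    and iso: "\<And>l. l \<in> L \<Longrightarrow> (l, u) \<notin> parcs G"
    and co: "nonadj_trans (induced G L)" and ne: "parcs (induced G L) \<noteq> {}"
  shows "\<chi>\<^sub>D (disjoint_union G G) \<le> card (pverts G)"
proof -
  let ?U = "disjoint_union G G"
  obtain p where p: "p \<in> L" using ne by auto
  define c2 where "c2 k = (if k = u then p else if k = p then u else k)" for k
  have "distinguishing ?U (case_sum id c2)"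
  proof (rule distinguishing_double_isolated[OF G V iso co ne])
    show "inj_on id L" "inj_on c2 L" "id u \<noteq> c2 u"
      using V(2) p by (auto simp: inj_on_def c2_def)
    fix \<sigma> assume "\<And>l. l \<in> L \<Longrightarrow> \<sigma> l \<in> L \<and> c2 (\<sigma> l) = id l"
    from this[OF p] show False using V(2) p by (auto simp: c2_def split: if_splits)
  qed
  then have "\<chi>\<^sub>D ?U \<le> card (case_sum id c2 ` pverts ?U)"
    by (rule chi_D_le[OF pair_graph_disjoint_union[OF G G]])
  also have "\<dots> \<le> card (pverts G)"
  proof (rule card_mono)
    show "finite (pverts G)" using pair_graphD(1)[OF G] .
    have "c2 z \<in> pverts G" if "z \<in> pverts G" for z using that V(1) p by (auto simp: c2_def)
    then show "case_sum id c2 ` pverts ?U \<subseteq> pverts G" by auto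
  qed
  finally show ?thesis .
qed

text \<open>With at most \<open>card L\<close> colours each of the two cliques uses every colour
  exactly once. Matching equal colours is a bijection between cliques, hence extends to a nontrivial
  colour-preserving automorphism that leaves both isolated vertices in place.\<close>

lemma chi_D_double_isolated_complete_gt:
  fixes G :: "'a pair_pre_digraph"
  assumes G: "pair_graph G" and V: "pverts G = insert u L" "u \<notin> L"
    and iso: "\<And>l. l \<in> L \<Longrightarrow> (l, u) \<notin> parcs G" and L: "L \<noteq> {}"
    and complete: "\<And>l m. l \<in> L \<Longrightarrow> m \<in> L \<Longrightarrow> l \<noteq> m \<Longrightarrow> (l, m) \<in> parcs G"
  shows "card L < \<chi>\<^sub>D (disjoint_union G G)"
proof (rule ccontr)
  let ?U = "disjoint_union G G"
  assume contr: "\<not> ?thesis"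
  have U: "pair_graph ?U" using pair_graph_disjoint_union[OF G G] .
  obtain c :: "'a + 'a \<Rightarrow> ('a + 'a) set"
    where c: "distinguishing ?U c" "card (c ` pverts ?U) = \<chi>\<^sub>D ?U"
    by (rule chi_D_attained[OF U])
  let ?K = "c ` pverts ?U"
  define cl where "cl = c \<circ> Inl"
  define cr where "cr = c \<circ> Inr"
  have adjL: "(l, m) \<in> parcs G \<longleftrightarrow> l \<noteq> m" if "l \<in> L" "m \<in> L" for l m
    using complete[OF that] pair_graphD(5)[OF G] by auto
  have inj: "inj_on cl L" "inj_on cr L"
  proof -
    have "cl l \<noteq> cl m" "cr l \<noteq> cr m" if "l \<in> L" "m \<in> L" "l \<noteq> m" for l m
      using distinguishingD(1)[OF c(1), of "Inl l" "Inl m"] distinguishingD(1)[OF c(1), of "Inr l" "Inr m"]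
        complete[OF that] by (simp_all add: cl_def cr_def)
    then show "inj_on cl L" "inj_on cr L" unfolding inj_on_def by metis+
  qed
  have fin: "finite ?K" using pair_graphD(1)[OF U] by simp
  \<comment> \<open>Injectivity gives each image \<open>card L\<close> elements, and by assumption
    there are no more colours than that.\<close>
  have "cl ` L = ?K" "cr ` L = ?K"
    using card_image[OF inj(1)] card_image[OF inj(2)] contr c(2) V(1)
    by (intro card_seteq[OF fin]; force simp: cl_def cr_def)+
  then have im: "cl ` L = cr ` L" by simp
  define \<sigma> where "\<sigma> l = inv_into L cr (cl l)" for l
  define \<tau> where "\<tau> l = inv_into L cl (cr l)" for l
  have s: "\<sigma> l \<in> L" "cr (\<sigma> l) = cl l" if "l \<in> L" for l
    unfolding \<sigma>_def using that im by (metis imageI inv_into_into, metis f_inv_into_f imageI)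
  have t: "\<tau> l \<in> L" "cl (\<tau> l) = cr l" if "l \<in> L" for l
    unfolding \<tau>_def using that im by (metis imageI inv_into_into, metis f_inv_into_f imageI)
  have ts: "\<tau> (\<sigma> l) = l" and st: "\<sigma> (\<tau> l) = l" if "l \<in> L" for l
    using s t that inj_onD[OF inj(1)] inj_onD[OF inj(2)] by metis+
  define f where "f = case_sum (\<lambda>l. if l \<in> L then Inr (\<sigma> l) else Inl l)
    (\<lambda>l. if l \<in> L then Inl (\<tau> l) else Inr l)"
  have ff: "f (f p) = p" if "p \<in> pverts ?U" for p
    using that s t st ts by (cases p) (auto simp: f_def)
  have fU: "f p \<in> pverts ?U" if "p \<in> pverts ?U" for p
    using that s t V by (cases p) (auto simp: f_def)
  have "bij_betw f (pverts ?U) (pverts ?U)"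
    by (intro bij_betw_byWitness[where f' = f] ballI image_subsetI; (rule ff fU); assumption)
  moreover have "(f p, f q) \<in> parcs ?U \<longleftrightarrow> (p, q) \<in> parcs ?U" if "p \<in> pverts ?U" "q \<in> pverts ?U" for p q
  proof -
    have uL: "(u, l) \<notin> parcs G" if "l \<in> L" for l using iso[OF that] adj_sym[OF G] by metis
    have "\<sigma> l = \<sigma> m \<longleftrightarrow> l = m" "\<tau> l = \<tau> m \<longleftrightarrow> l = m" if "l \<in> L" "m \<in> L" for l m
      using that st ts by metis+
    then show ?thesis
      using that V iso uL adjL s(1) t(1) pair_graphD(5)[OF G]
      by (cases p; cases q) (auto simp: f_def)
  qed
  ultimately have "vertex_iso f ?U ?U" by (simp add: vertex_iso_def)
  moreover have "c (f p) = c p" if "p \<in> pverts ?U" for p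
    using that s t V by (cases p) (auto simp: f_def cl_def cr_def)
  moreover obtain l where "l \<in> L" using L by blast
  ultimately have "f (Inl l) = Inl l" using V by (intro distinguishingD(2)[OF c(1)]) auto
  then show False using \<open>l \<in> L\<close> by (simp add: f_def)
qed

section \<open>Two copies of \<open>2K2\<close>\<close>

text \<open>The colours along an arc identify its tail, and every vertex is a tail; a
  colour-preserving automorphism carries an arc to one with the same colours, so it fixes the
  tail.\<close>

lemma distinguishing_of_arcs:
  assumes "\<And>p q. (p, q) \<in> parcs G \<Longrightarrow> c p \<noteq> c q"
    and arc: "\<And>p. p \<in> pverts G \<Longrightarrow> \<exists>q \<in> pverts G. (p, q) \<in> parcs G"
    and det: "\<And>p p' q q'. (p, p') \<in> parcs G \<Longrightarrow> (q, q') \<in> parcs G \<Longrightarrow> c p = c q \<Longrightarrow> c p' = c q' \<Longrightarrow> p = q"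
  shows "distinguishing G c"
proof (rule distinguishingI)
  fix f z assume f: "vertex_iso f G G" "\<And>v. v \<in> pverts G \<Longrightarrow> c (f v) = c v" "z \<in> pverts G"
  obtain w where w: "w \<in> pverts G" "(z, w) \<in> parcs G" using arc[OF f(3)] by blast
  then have "(f z, f w) \<in> parcs G" using vertex_isoD(2)[OF f(1) f(3)] by blast
  then show "f z = z" using det w f(2)[OF f(3)] f(2)[OF w(1)] by blast
qed (use assms in blast)

text \<open>The map \<open>\<mu>\<close> sends a vertex to its partner. Two different edges with the
  same colours in corresponding order could be exchanged by an automorphism that fixes everything
  else.\<close>

lemma distinguishing_perfect_matching:
  assumes G: "pair_graph G" and c: "distinguishing G c"
    and \<mu>: "\<And>w. w \<in> pverts G \<Longrightarrow> \<mu> w \<in> pverts G"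
      "\<And>w z. w \<in> pverts G \<Longrightarrow> (w, z) \<in> parcs G \<longleftrightarrow> z = \<mu> w"
    and pq: "p \<in> pverts G" "q \<in> pverts G" "p \<noteq> q" "q \<noteq> \<mu> p"
  shows "\<not> (c p = c q \<and> c (\<mu> p) = c (\<mu> q))"
proof
  assume eq: "c p = c q \<and> c (\<mu> p) = c (\<mu> q)"
  have \<mu>\<mu>: "\<mu> (\<mu> w) = w" if "w \<in> pverts G" for w
    using \<mu>(2)[OF that, of "\<mu> w"] \<mu>(2)[OF \<mu>(1)[OF that], of w] adj_sym[OF G, of w "\<mu> w"] by simp
  have nl: "\<mu> w \<noteq> w" if "w \<in> pverts G" for w
    using \<mu>(2)[OF that, of w] pair_graphD(5)[OF G] by auto
  have ne: "p \<noteq> \<mu> p" "q \<noteq> \<mu> q" "p \<noteq> \<mu> q" "\<mu> p \<noteq> \<mu> q"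
    using nl pq \<mu>\<mu> by metis+
  define f where "f w = (if w = p then q else if w = q then p else
    if w = \<mu> p then \<mu> q else if w = \<mu> q then \<mu> p else w)" for w
  have ff: "f (f w) = w" for w using pq ne by (auto simp: f_def)
  have fG: "f w \<in> pverts G" if "w \<in> pverts G" for w using that pq \<mu>(1) by (auto simp: f_def)
  have f\<mu>: "\<mu> (f w) = f (\<mu> w)" if w: "w \<in> pverts G" for w
  proof -
    have "\<mu> w = p \<longleftrightarrow> w = \<mu> p" "\<mu> w = q \<longleftrightarrow> w = \<mu> q" "\<mu> w = \<mu> p \<longleftrightarrow> w = p" "\<mu> w = \<mu> q \<longleftrightarrow> w = q"
      using \<mu>\<mu> w pq by metis+
    then show ?thesis using pq ne \<mu>\<mu> by (auto simp: f_def)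
  qed
  have "bij_betw f (pverts G) (pverts G)"
    by (rule bij_betw_byWitness[where f' = f]) (use ff fG in auto)
  moreover have "(f w, f z) \<in> parcs G \<longleftrightarrow> (w, z) \<in> parcs G" if "w \<in> pverts G" for w z
    using \<mu>(2)[OF that] \<mu>(2)[OF fG[OF that]] f\<mu>[OF that] ff by metis
  ultimately have "vertex_iso f G G" by (simp add: vertex_iso_def)
  then have "f p = p"
    by (rule distinguishingD(2)[OF c]) (use eq pq ne in \<open>auto simp: f_def\<close>)
  then show False using pq by (simp add: f_def)
qed

lemma chi_D_double_2K2:
  fixes G :: "'a pair_pre_digraph"
  assumes G: "pair_graph G" and j: "join_2K2 G {} u v x y"
  shows "\<chi>\<^sub>D (disjoint_union G G) = 4"
proof (rule antisym)
  let ?U = "disjoint_union G G"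
  have U: "pair_graph ?U" using pair_graph_disjoint_union[OF G G] .
  have V: "pverts G = {u, v, x, y}" and d: "distinct [u, v, x, y]"
    using j by (simp_all add: join_2K2_def)
  have E: "parcs G = {(u, v), (v, u), (x, y), (y, x)}"
  proof (intro equalityI subrelI)
    fix p q assume pq: "(p, q) \<in> parcs G"
    then have "p \<in> {u, v, x, y}" "q \<in> {u, v, x, y}" using pair_graphD(2,3)[OF G pq] V by auto
    then show "(p, q) \<in> {(u, v), (v, u), (x, y), (y, x)}"
      using j pq pair_graphD(4)[OF G pq] pair_graphD(5)[OF G] by (auto simp: join_2K2_def)
  next
    fix p q assume "(p, q) \<in> {(u, v), (v, u), (x, y), (y, x)}"
    then show "(p, q) \<in> parcs G"
      using j adj_sym[OF G, of v u] adj_sym[OF G, of y x] by (auto simp: join_2K2_def)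
  qed
  \<comment> \<open>The edges of the second copy get the colours \<open>u x\<close> and
    \<open>u y\<close>, those of the first \<open>u v\<close> and \<open>x y\<close>: four different
    colour pairs from four colours.\<close>
  define c2 where "c2 z = (if z = v then x else if z = x then u else z)" for z
  have UE: "parcs ?U = {(Inl u, Inl v), (Inl v, Inl u), (Inl x, Inl y), (Inl y, Inl x),
      (Inr u, Inr v), (Inr v, Inr u), (Inr x, Inr y), (Inr y, Inr x)}"
    by (auto simp: disjoint_union_def E)
  have "distinguishing ?U (case_sum id c2)"
  proof (rule distinguishing_of_arcs)
    show "case_sum id c2 p \<noteq> case_sum id c2 q" if "(p, q) \<in> parcs ?U" for p q
      using that d unfolding UE by (auto simp: c2_def)
    show "\<exists>q \<in> pverts ?U. (p, q) \<in> parcs ?U" if "p \<in> pverts ?U" for p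
      using that unfolding UE by (auto simp: V)
    show "p = q" if "(p, p') \<in> parcs ?U" "(q, q') \<in> parcs ?U"
      "case_sum id c2 p = case_sum id c2 q" "case_sum id c2 p' = case_sum id c2 q'" for p p' q q'
      using that d unfolding UE by (auto simp: c2_def)
  qed
  then have "\<chi>\<^sub>D ?U \<le> card (case_sum id c2 ` pverts ?U)" by (rule chi_D_le[OF U])
  also have "\<dots> \<le> card {u, v, x, y}" by (rule card_mono) (auto simp: V c2_def)
  also have "\<dots> = 4" using d by simp
  finally show "\<chi>\<^sub>D ?U \<le> 4" .
  show "4 \<le> \<chi>\<^sub>D ?U"
  proof (rule ccontr)
    obtain c :: "'a + 'a \<Rightarrow> ('a + 'a) set"
      where c: "distinguishing ?U c" "card (c ` pverts ?U) = \<chi>\<^sub>D ?U"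
      by (rule chi_D_attained[OF U])
    \<comment> \<open>\<open>?F\<close> contains one end of each of the four edges, and
      \<open>h\<close> below records the colour set of that edge. Three colours offer only three
      such sets, so two edges agree.\<close>
    let ?K = "c ` pverts ?U" and ?F = "{Inl u, Inl x, Inr u, Inr x} :: ('a + 'a) set"
    assume "\<not> 4 \<le> \<chi>\<^sub>D ?U"
    then have K: "card ?K \<le> 3" "finite ?K" using c(2) pair_graphD(1)[OF U] by auto
    define m where "m z = (if z = u then v else if z = v then u else if z = x then y else x)" for z
    define \<mu> where "\<mu> = map_sum m m"
    have m: "m w \<in> pverts G" "(w, z) \<in> parcs G \<longleftrightarrow> z = m w" if "w \<in> pverts G" for w z
      using that d unfolding V E m_def by auto
    have \<mu>: "\<mu> w \<in> pverts ?U" "(w, z) \<in> parcs ?U \<longleftrightarrow> z = \<mu> w" if "w \<in> pverts ?U" for w z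
      using that m by (cases w; cases z; auto simp: \<mu>_def)+
    have swap: "\<not> (c p = c q \<and> c (\<mu> p) = c (\<mu> q))"
      if "p \<in> pverts ?U" "q \<in> pverts ?U" "p \<noteq> q" "q \<noteq> \<mu> p" for p q
      by (rule distinguishing_perfect_matching[OF U c(1), where \<mu> = \<mu>]) (fact \<mu> that)+
    define h where "h p = {c p, c (\<mu> p)}" for p
    have F: "p \<in> pverts ?U" if "p \<in> ?F" for p using that by (auto simp: V)
    have "h ` ?F \<subseteq> {B. B \<subseteq> ?K \<and> card B = 2}"
    proof (rule image_subsetI)
      fix p assume p: "p \<in> ?F"
      have "h p \<subseteq> ?K" using F[OF p] \<mu>(1)[OF F[OF p]] unfolding h_def by blast
      moreover have "c p \<noteq> c (\<mu> p)" using distinguishingD(1)[OF c(1)] \<mu>(2)[OF F[OF p]] by blast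
      ultimately show "h p \<in> {B. B \<subseteq> ?K \<and> card B = 2}" by (simp add: h_def)
    qed
    then have "card (h ` ?F) \<le> card ?K choose 2"
      using K(2) by (subst n_subsets[symmetric]) (auto intro: card_mono)
    also have "\<dots> \<le> 3 choose 2" using K(1) by (rule binomial_right_mono)
    also have "\<dots> < card ?F" using d by (simp add: choose_two)
    finally have "\<not> inj_on h ?F" using card_image[of h ?F] by auto
    then obtain p q where pq: "p \<in> ?F" "q \<in> ?F" "p \<noteq> q" "h p = h q" unfolding inj_on_def by blast
    have ne: "q \<noteq> \<mu> p" "p \<noteq> \<mu> q" using pq d by (auto simp: \<mu>_def m_def)
    have \<mu>\<mu>: "\<mu> (\<mu> p) = p" "\<mu> (\<mu> q) = q" using pq d by (auto simp: \<mu>_def m_def)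
    \<comment> \<open>Equal colour sets may match in either orientation. In the second one
      \<open>q\<close> is replaced by its partner before the edges are exchanged.\<close>
    from pq(4) consider "c p = c q" "c (\<mu> p) = c (\<mu> q)" | "c p = c (\<mu> q)" "c (\<mu> p) = c q"
      by (auto simp: h_def doubleton_eq_iff)
    then show False
    proof cases
      case 1
      then show False using swap[OF F[OF pq(1)] F[OF pq(2)] pq(3) ne(1)] by blast
    next
      case 2
      have "\<mu> q \<noteq> \<mu> p" using \<mu>\<mu> pq(3) by metis
      then show False
        using swap[OF F[OF pq(1)] \<mu>(1)[OF F[OF pq(2)]] ne(2)] 2 \<mu>\<mu> by simp
    qed
  qed
qed

section \<open>From vertex sets of \<open>G\<close> to the graphs named in the theorem\<close>

lemma vertex_iso_complete_graph_iff:
  assumes f: "vertex_iso f G H" and G: "pair_graph G" and H: "pair_graph H"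
  shows "G \<simeq> complete_graph k \<longleftrightarrow> H \<simeq> complete_graph k"
proof -
  have "card (pverts H) = card (pverts G)"
    using bij_betw_same_card f unfolding vertex_iso_def by metis
  moreover have "f u = f v \<longleftrightarrow> u = v" if "u \<in> pverts G" "v \<in> pverts G" for u v
    using vertex_isoD(3)[OF f] that by (auto dest: inj_onD)
  ultimately show ?thesis
    unfolding isomorphic_complete_graph_iff[OF G] isomorphic_complete_graph_iff[OF H]
    by (simp add: vertex_isoD(4)[OF f, symmetric] vertex_isoD(2)[OF f])
qed

lemma induced_self: "pair_graph G \<Longrightarrow> induced G (pverts G) = G"
  by (cases G) (auto simp: induced_def pair_graph_iff)

lemma induced_join_2K2:
  assumes G: "pair_graph G" and j: "join_2K2 G M u v x y"
  shows "induced G {u, v, x, y} \<simeq> disjoint_union (complete_graph 2) (complete_graph 2)"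
proof -
  let ?G = "induced G {u, v, x, y}"
  have V: "{u, v, x, y} \<subseteq> pverts G" and d: "u \<noteq> v" "x \<noteq> y" and dj: "{u, v} \<inter> {x, y} = {}"
    and adj: "(u, v) \<in> parcs G" "(x, y) \<in> parcs G"
    and nadj: "p \<in> {u, v} \<Longrightarrow> q \<in> {x, y} \<Longrightarrow> (p, q) \<notin> parcs G" for p q
    using j by (auto simp: join_2K2_def)
  have G4: "pair_graph ?G" using pair_graph_induced[OF G V] .
  have K2: "induced ?G {p, q} \<simeq> complete_graph 2"
    if "p \<noteq> q" "(p, q) \<in> parcs G" "{p, q} \<subseteq> {u, v, x, y}" for p q
  proof -
    have "(q, p) \<in> parcs G" using that(2) by (rule pair_graphD(4)[OF G])
    moreover have "pair_graph (induced G {p, q})" using that(3) V by (intro pair_graph_induced[OF G]) blast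
    ultimately show ?thesis
      unfolding induced_induced[OF that(3)] using that(1,2)
      by (subst isomorphic_complete_graph_iff) auto
  qed
  show ?thesis
  proof (rule isomorphic_disjoint_unionI[OF G4 pair_graph_complete_graph pair_graph_complete_graph _ dj])
    show "pverts ?G = {u, v} \<union> {x, y}" by auto
    show "(p, q) \<notin> parcs ?G" if "p \<in> {u, v}" "q \<in> {x, y}" for p q using nadj[OF that] by simp
  qed (use K2 d adj in auto)
qed

lemma isomorphic_disjoint_union_isolated:
  assumes G: "pair_graph G" and uL: "insert u L \<subseteq> pverts G" "u \<notin> L"
    and iso: "\<And>l. l \<in> L \<Longrightarrow> (l, u) \<notin> parcs G"
    and H: "pair_graph H" "induced G L \<simeq> H"
  shows "induced G (insert u L) \<simeq> disjoint_union H (complete_graph 1)"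
proof -
  let ?G = "induced G (insert u L)"
  have G': "pair_graph ?G" using pair_graph_induced[OF G uL(1)] .
  have "pair_graph (induced G {u})" using uL(1) by (intro pair_graph_induced[OF G]) blast
  then have "induced G {u} \<simeq> complete_graph 1"
    by (subst isomorphic_complete_graph_iff) auto
  then have "induced ?G {u} \<simeq> complete_graph 1" "induced ?G L \<simeq> H"
    using H(2) induced_induced[of "{u}" "insert u L" G] induced_induced[of L "insert u L" G]
    by (simp_all add: subset_insertI)
  then show ?thesis
    by (intro isomorphic_disjoint_unionI[OF G' H(1) pair_graph_complete_graph, of L "{u}"])
      (use uL iso in auto)
qed

lemma ex_complete_multipartite_copy:
  assumes G: "pair_graph G" and X: "X \<subseteq> pverts G" and co: "nonadj_trans (induced G X)"
  obtains M :: "nat pair_pre_digraph" and f where "complete_multipartite M"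
    "vertex_iso f (induced G X) M" "induced G X \<simeq> M"
proof -
  obtain M :: "nat pair_pre_digraph" and f
    where M: "pair_graph M" "vertex_iso f (induced G X) M" "induced G X \<simeq> M"
    using ex_nat_graph[OF pair_graph_induced[OF G X]] by metis
  then have "complete_multipartite M"
    using nonadj_trans_iso[OF M(2)] co by (simp add: complete_multipartite_iff)
  then show thesis using M(2,3) by (rule that)
qed

lemma ex_complete_multipartite_ge2_copy:
  assumes G: "pair_graph G" and X: "X \<subseteq> pverts G" and co: "nonadj_trans (induced G X)"
    and ne: "parcs (induced G X) \<noteq> {}"
  obtains H :: "nat pair_pre_digraph" and f where "complete_multipartite_ge2 H"
    "vertex_iso f (induced G X) H" "induced G X \<simeq> H"
proof -
  obtain H :: "nat pair_pre_digraph" and f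
    where H: "complete_multipartite H" "vertex_iso f (induced G X) H" "induced G X \<simeq> H"
    by (rule ex_complete_multipartite_copy[OF G X co])
  then have "complete_multipartite_ge2 H"
    using vertex_iso_parcs_empty[OF H(2) pair_graph_induced[OF G X]] ne
    by (simp add: complete_multipartite_ge2_iff complete_multipartite_iff)
  then show thesis using H(2,3) by (rule that)
qed

text \<open>Vertices on different sides of a join are adjacent, and vertices on the same side share
  a neighbour on the other, so the bound for distance at most two applies. The third vertex
  \<open>t\<close> exists because \<open>G\<close> has more than two vertices.\<close>

lemma chi_D_double_join:
  fixes G :: "'a pair_pre_digraph"
  assumes G: "pair_graph G" and card: "card (pverts G) > 2" and chi: "\<chi>\<^sub>D G = card (pverts G) - 1"
    and A: "pair_graph A" "pverts A \<noteq> {}" and B: "pair_graph B" "pverts B \<noteq> {}"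
    and iso: "G \<simeq> join A B"
  shows "\<chi>\<^sub>D (disjoint_union G G) = \<chi>\<^sub>D G"
proof (rule antisym)
  obtain X Y where XY: "pverts G = X \<union> Y" "X \<noteq> {}" "Y \<noteq> {}"
    and adj: "\<And>x y. x \<in> X \<Longrightarrow> y \<in> Y \<Longrightarrow> (x, y) \<in> parcs G"
    using isomorphic_joinE[OF G A(1) B(1) iso A(2) B(2)] by metis
  have adj': "(y, x) \<in> parcs G" if "x \<in> X" "y \<in> Y" for x y
    using adj[OF that] by (rule pair_graphD(4)[OF G])
  have "\<chi>\<^sub>D G < card (pverts G)" using chi card by linarith
  then obtain u x where b: "bad G u x" using ex_bad[OF G] by blast
  have "\<not> pverts G \<subseteq> {u, x}"
  proof
    assume "pverts G \<subseteq> {u, x}"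
    then have "card (pverts G) \<le> card {u, x}" by (rule card_mono[rotated]) simp
    also have "\<dots> \<le> 2" by (simp add: card_insert_if)
    finally show False using card by simp
  qed
  then obtain t where t: "t \<in> pverts G" "t \<noteq> u" "t \<noteq> x" by blast
  have "p = q \<or> (p, q) \<in> parcs G \<or> (\<exists>w. (p, w) \<in> parcs G \<and> (w, q) \<in> parcs G)"
    if "p \<in> pverts G" "q \<in> pverts G" for p q
  proof -
    obtain x0 y0 where "x0 \<in> X" "y0 \<in> Y" using XY by blast
    then show ?thesis using that adj adj' unfolding XY(1) by blast
  qed
  from chi_D_double_diameter2[OF G b t this]
  show "\<chi>\<^sub>D (disjoint_union G G) \<le> \<chi>\<^sub>D G" using chi by simp
  show "\<chi>\<^sub>D G \<le> \<chi>\<^sub>D (disjoint_union G G)" by (rule chi_D_disjoint_union_ge[OF G])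
qed

lemma isomorphic_disjoint_union_K1E:
  assumes G: "pair_graph G" and H: "pair_graph H" and iso: "G \<simeq> disjoint_union H (complete_graph 1)"
  obtains u L where "pverts G = insert u L" "u \<notin> L" "\<forall>l \<in> L. (l, u) \<notin> parcs G"
    "pair_graph (induced G L)" "induced G L \<simeq> H"
proof -
  obtain X Y where XY: "pverts G = X \<union> Y" "X \<inter> Y = {}"
    and n: "\<forall>x \<in> X. \<forall>y \<in> Y. (x, y) \<notin> parcs G"
    and isos: "induced G X \<simeq> H" "induced G Y \<simeq> complete_graph 1"
    by (rule isomorphic_disjoint_unionE[OF G H pair_graph_complete_graph iso])
  have sub: "X \<subseteq> pverts G" "Y \<subseteq> pverts G" using XY(1) by auto
  have "card Y = 1"
    using isos(2) unfolding isomorphic_complete_graph_iff[OF pair_graph_induced[OF G sub(2)]] by simp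
  then obtain u where u: "Y = {u}" by (rule card_1_singletonE)
  show thesis
    by (rule that[of u X]) (use XY n isos(1) u pair_graph_induced[OF G sub(1)] in auto)
qed

theorem theorem5p10:
  fixes G :: "'a pair_pre_digraph" and n :: nat
  assumes "pair_graph G"
    and "card (pverts G) = n"
    and "n > 3"
    and "\<chi>\<^sub>D G = n - 1"
  shows
    "(\<chi>\<^sub>D (disjoint_union G G) = \<chi>\<^sub>D G \<longleftrightarrow>
        (\<exists>M :: nat pair_pre_digraph. complete_multipartite M \<and> pverts M \<noteq> {} \<and>
           (G \<simeq> join M (disjoint_union (complete_graph 2) (complete_graph 2)) \<or>
            (\<exists>H :: nat pair_pre_digraph. complete_multipartite_ge2 H \<and>
               G \<simeq> join M (disjoint_union H (complete_graph 1)))))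
        \<or>
        (\<exists>H :: nat pair_pre_digraph. complete_multipartite_ge2 H \<and>
           G \<simeq> disjoint_union H (complete_graph 1) \<and>
           \<not> H \<simeq> complete_graph (n - 1)))
     \<and>
     (\<chi>\<^sub>D (disjoint_union G G) = \<chi>\<^sub>D G + 1 \<longleftrightarrow>
        G \<simeq> disjoint_union (complete_graph 2) (complete_graph 2) \<or>
        G \<simeq> disjoint_union (complete_graph (n - 1)) (complete_graph 1))"
    (is "(?same \<longleftrightarrow> ?a1 \<or> ?a2) \<and> (?succ \<longleftrightarrow> ?b1 \<or> ?b2)")
proof -
  note G = assms(1)
  have chi: "\<chi>\<^sub>D G = card (pverts G) - 1" using assms by simp
  note K = pair_graph_complete_graph and ge = chi_D_disjoint_union_ge[OF G]
  have a1: ?same if ?a1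
  proof -
    \<comment> \<open>Both alternatives are treated at once: for the bound only the nonemptiness of
      the second factor \<open>C\<close> matters.\<close>
    obtain M :: "nat pair_pre_digraph" and C :: "(nat + nat) pair_pre_digraph"
      where M: "complete_multipartite M" "pverts M \<noteq> {}"
        and C: "pair_graph C" "pverts C \<noteq> {}" "G \<simeq> join M C"
    proof -
      obtain M :: "nat pair_pre_digraph" where M: "complete_multipartite M" "pverts M \<noteq> {}"
        and iso: "G \<simeq> join M (disjoint_union (complete_graph 2) (complete_graph 2)) \<or>
          (\<exists>H :: nat pair_pre_digraph. complete_multipartite_ge2 H \<and>
             G \<simeq> join M (disjoint_union H (complete_graph 1)))"
        using \<open>?a1\<close> by blast
      from iso show thesis
      proof (elim disjE exE conjE)
        assume i: "G \<simeq> join M (disjoint_union (complete_graph 2) (complete_graph 2))"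
        have "Inl 0 \<in> pverts (disjoint_union (complete_graph 2) (complete_graph 2))" by simp
        then have "pverts (disjoint_union (complete_graph 2) (complete_graph 2)) \<noteq> {}" by (metis empty_iff)
        then show thesis using that[OF M pair_graph_disjoint_union[OF K K] _ i] by blast
      next
        fix H :: "nat pair_pre_digraph"
        assume H: "complete_multipartite_ge2 H" and i: "G \<simeq> join M (disjoint_union H (complete_graph 1))"
        have "Inr 0 \<in> pverts (disjoint_union H (complete_graph 1))" by simp
        then have "pverts (disjoint_union H (complete_graph 1)) \<noteq> {}" by (metis empty_iff)
        moreover have "pair_graph H" using H by (simp add: complete_multipartite_ge2_iff)
        ultimately show thesis using that[OF M pair_graph_disjoint_union[OF _ K] _ i] by blast
      qed
    qed
    show ?same
      by (rule chi_D_double_join[OF G _ chi _ M(2) C(1,2,3)])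
        (use assms M in \<open>auto simp: complete_multipartite_iff\<close>)
  qed
  have a2: ?same if ?a2
  proof -
    obtain H :: "nat pair_pre_digraph" where H: "complete_multipartite_ge2 H"
      and iso: "G \<simeq> disjoint_union H (complete_graph 1)" and nK: "\<not> H \<simeq> complete_graph (n - 1)"
      using \<open>?a2\<close> by blast
    have H': "pair_graph H" using H by (simp add: complete_multipartite_ge2_iff)
    obtain u L where V: "pverts G = insert u L" "u \<notin> L"
      and n: "\<forall>l \<in> L. (l, u) \<notin> parcs G"
      and L: "pair_graph (induced G L)" "induced G L \<simeq> H"
      by (rule isomorphic_disjoint_union_K1E[OF G H' iso])
    obtain f where f: "vertex_iso f (induced G L) H"
      using L(2) isomorphic_vertex_iso[OF L(1) H'] by blast
    have co: "nonadj_trans (induced G L)" and ne: "parcs (induced G L) \<noteq> {}"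
      using H nonadj_trans_iso[OF f] vertex_iso_parcs_empty[OF f L(1) H']
      by (simp_all add: complete_multipartite_ge2_iff)
    have "finite L" using pair_graphD(1)[OF G] V by simp
    then have cL: "card L = n - 1" using V assms(2) by simp
    have "\<not> induced G L \<simeq> complete_graph (n - 1)"
      using nK vertex_iso_complete_graph_iff[OF f L(1) H'] by blast
    then obtain a b where ab: "a \<in> L" "b \<in> L" "a \<noteq> b" "(a, b) \<notin> parcs G"
      unfolding isomorphic_complete_graph_iff[OF L(1)] using cL by auto
    have "\<chi>\<^sub>D (disjoint_union G G) \<le> card L"
      by (rule chi_D_double_isolated_noncomplete[OF G V bspec[OF n] co ne ab])
    then show ?same using ge cL assms(4) by simp
  qed
  have b1: ?succ if ?b1
  proof -
    obtain X Y where XY: "pverts G = X \<union> Y" "X \<inter> Y = {}"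
      and nadj: "\<forall>x \<in> X. \<forall>y \<in> Y. (x, y) \<notin> parcs G"
      and isos: "induced G X \<simeq> complete_graph 2" "induced G Y \<simeq> complete_graph 2"
      by (rule isomorphic_disjoint_unionE[OF G K K \<open>?b1\<close>])
    have sub: "X \<subseteq> pverts G" "Y \<subseteq> pverts G" using XY(1) by auto
    have X: "card X = 2" "\<And>u v. u \<in> X \<Longrightarrow> v \<in> X \<Longrightarrow> u \<noteq> v \<Longrightarrow> (u, v) \<in> parcs G"
      using isos(1) unfolding isomorphic_complete_graph_iff[OF pair_graph_induced[OF G sub(1)]] by auto
    have Y: "card Y = 2" "\<And>u v. u \<in> Y \<Longrightarrow> v \<in> Y \<Longrightarrow> u \<noteq> v \<Longrightarrow> (u, v) \<in> parcs G"
      using isos(2) unfolding isomorphic_complete_graph_iff[OF pair_graph_induced[OF G sub(2)]] by auto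
    obtain u v where uv: "X = {u, v}" "u \<noteq> v" using X(1) by (auto simp: card_2_iff)
    obtain x y where xy: "Y = {x, y}" "x \<noteq> y" using Y(1) by (auto simp: card_2_iff)
    have "(u, v) \<in> parcs G" "(x, y) \<in> parcs G" using X(2) Y(2) uv xy by auto
    moreover have "nonadj_trans (induced G {})" by (simp add: nonadj_trans_def)
    ultimately have j: "join_2K2 G {} u v x y"
      unfolding join_2K2_def using XY uv xy nadj by auto
    have "distinct [u, v, x, y]" "pverts G = {u, v, x, y}" using j by (simp_all add: join_2K2_def)
    \<comment> \<open>This matches the value \<open>4\<close> for two copies with
      \<open>n - 1 = 3\<close> for one.\<close>
    then have "n = 4" using assms(2) by simp
    then show ?succ using chi_D_double_2K2[OF G j] assms(4) by simp
  qed
  have b2: ?succ if ?b2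
  proof -
    obtain u L where V: "pverts G = insert u L" "u \<notin> L"
      and n: "\<forall>l \<in> L. (l, u) \<notin> parcs G"
      and L: "pair_graph (induced G L)" "induced G L \<simeq> complete_graph (n - 1)"
      by (rule isomorphic_disjoint_union_K1E[OF G K \<open>?b2\<close>])
    have cL: "card L = n - 1" and comp: "\<And>l m. l \<in> L \<Longrightarrow> m \<in> L \<Longrightarrow> l \<noteq> m \<Longrightarrow> (l, m) \<in> parcs G"
      using L(2) unfolding isomorphic_complete_graph_iff[OF L(1)] by auto
    have "\<not> card L \<le> Suc 0" "L \<noteq> {}" "finite L" using cL assms(3) by (auto intro: card_ge_0_finite)
    then obtain a b where "a \<in> L" "b \<in> L" "a \<noteq> b" using card_le_Suc0_iff_eq by blast
    then have "(a, b) \<in> parcs (induced G L)" using comp by simp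
    then have ne: "parcs (induced G L) \<noteq> {}" by (metis empty_iff)
    have co: "nonadj_trans (induced G L)"
      unfolding nonadj_trans_def
    proof (intro ballI impI)
      fix p q r assume *: "p \<in> pverts (induced G L)" "q \<in> pverts (induced G L)"
        "r \<in> pverts (induced G L)" "(p, r) \<in> parcs (induced G L)"
      then show "(p, q) \<in> parcs (induced G L) \<or> (q, r) \<in> parcs (induced G L)"
        using comp[of p q] by (cases "p = q") auto
    qed
    have "card L < \<chi>\<^sub>D (disjoint_union G G)"
      by (rule chi_D_double_isolated_complete_gt[OF G V bspec[OF n] \<open>L \<noteq> {}\<close> comp])
    moreover have "\<chi>\<^sub>D (disjoint_union G G) \<le> card (pverts G)"
      by (rule chi_D_double_isolated_le[OF G V bspec[OF n] co ne])
    ultimately show ?succ using cL assms by simp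
  qed
  \<comment> \<open>Exhaustiveness supplies the converse directions: each structure already
    determines one of the two values, and these values exclude each other.\<close>
  have "(?a1 \<or> ?a2) \<or> (?b1 \<or> ?b2)"
  proof -
    have "card (pverts G) \<ge> 2" using assms by simp
    then consider (A) M u v x y where "join_2K2 G M u v x y" | (B) R L u where "join_isolated G R L u"
      using chi_D_pred_cases[OF G _ chi] by blast
    then show ?thesis
    proof cases
      case A
      have V: "pverts G = M \<union> {u, v, x, y}" "M \<inter> {u, v, x, y} = {}"
        and adj: "\<And>m z. m \<in> M \<Longrightarrow> z \<in> {u, v, x, y} \<Longrightarrow> (m, z) \<in> parcs G"
        and co: "nonadj_trans (induced G M)"
        using A unfolding join_2K2_def by blast+
      have X: "induced G {u, v, x, y} \<simeq> disjoint_union (complete_graph 2) (complete_graph 2)"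
        by (rule induced_join_2K2[OF G A])
      show ?thesis
      proof (cases "M = {}")
        case True
        then show ?thesis using X induced_self[OF G] V(1) by simp
      next
        case False
        have "M \<subseteq> pverts G" using V(1) by blast
        then obtain M' :: "nat pair_pre_digraph" and f where M': "complete_multipartite M'"
          "vertex_iso f (induced G M) M'" "induced G M \<simeq> M'"
          by (rule ex_complete_multipartite_copy[OF G _ co])
        have "pair_graph M'" using M'(1) by (simp add: complete_multipartite_iff)
        then have "G \<simeq> join M' (disjoint_union (complete_graph 2) (complete_graph 2))"
          using isomorphic_joinI[OF G _ pair_graph_disjoint_union[OF K K] V adj M'(3) X] by blast
        moreover have "pverts M' \<noteq> {}" using vertex_isoD(4)[OF M'(2)] False by auto
        ultimately have ?a1 using M'(1) by blast
        then show ?thesis by blast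
      qed
    next
      case B
      have V: "pverts G = R \<union> insert u L" "R \<inter> insert u L = {}" and uL: "u \<notin> L"
        and adj: "\<And>m z. m \<in> R \<Longrightarrow> z \<in> insert u L \<Longrightarrow> (m, z) \<in> parcs G"
        and n: "\<And>l. l \<in> L \<Longrightarrow> (l, u) \<notin> parcs G"
        and co: "nonadj_trans (induced G R)" "nonadj_trans (induced G L)"
        and ne: "parcs (induced G L) \<noteq> {}"
        using B unfolding join_isolated_def by blast+
      have sub: "R \<subseteq> pverts G" "L \<subseteq> pverts G" "insert u L \<subseteq> pverts G" using V(1) by blast+
      have L: "pair_graph (induced G L)" using pair_graph_induced[OF G sub(2)] .
      obtain H :: "nat pair_pre_digraph" and h where H: "complete_multipartite_ge2 H"
        "vertex_iso h (induced G L) H" "induced G L \<simeq> H"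
        by (rule ex_complete_multipartite_ge2_copy[OF G sub(2) co(2) ne])
      have H': "pair_graph H" using H(1) by (simp add: complete_multipartite_ge2_iff)
      have X: "induced G (insert u L) \<simeq> disjoint_union H (complete_graph 1)"
        by (rule isomorphic_disjoint_union_isolated[OF G sub(3) uL n H' H(3)])
      show ?thesis
      proof (cases "R = {}")
        case True
        then have GV: "induced G (insert u L) = G" using induced_self[OF G] V(1) by simp
        show ?thesis
        \<comment> \<open>Without a join factor, completeness of \<open>H\<close> is what decides
          between the two values.\<close>
        proof (cases "H \<simeq> complete_graph (n - 1)")
          case True
          then have K': "induced G L \<simeq> complete_graph (n - 1)"
            using vertex_iso_complete_graph_iff[OF H(2) L H'] by blast
          have "induced G (insert u L) \<simeq> disjoint_union (complete_graph (n - 1)) (complete_graph 1)"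
            by (rule isomorphic_disjoint_union_isolated[OF G sub(3) uL n K K'])
          then show ?thesis using GV by simp
        next
          case False
          then have ?a2 using X H(1) GV by auto
          then show ?thesis by blast
        qed
      next
        case False
        obtain M :: "nat pair_pre_digraph" and f where M: "complete_multipartite M"
          "vertex_iso f (induced G R) M" "induced G R \<simeq> M"
          by (rule ex_complete_multipartite_copy[OF G sub(1) co(1)])
        have "pair_graph M" using M(1) by (simp add: complete_multipartite_iff)
        then have "G \<simeq> join M (disjoint_union H (complete_graph 1))"
          using isomorphic_joinI[OF G _ pair_graph_disjoint_union[OF H' K] V adj M(3) X] by blast
        moreover have "pverts M \<noteq> {}" using vertex_isoD(4)[OF M(2)] False by auto
        ultimately have ?a1 using M(1) H(1) by blast
        then show ?thesis by blast
      qed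
    qed
  qed
  moreover have "\<not> (?same \<and> ?succ)" by simp
  ultimately show ?thesis using a1 a2 b1 b2 by argo
qed

end
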